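(* Let $G$ be a finite group, let $K=x^G$ be the conjugacy class of an element $x\in G$, let $D=d^G\neq\{1\}$ be a non-trivial conjugacy class of $G$, and let $n\in\mathbb{N}$. Put $$m_1=\frac{|K|^n}{|G|}\sum_{\chi\in\mathrm{Irr}(G)}\frac{\chi(x)^n}{\chi(1)^{n-2}},\qquad m_2=\frac{|K|^n}{|G|}\sum_{\chi\in\mathrm{Irr}(G)}\frac{\chi(x)^n\,\overline{\chi(d)}}{\chi(1)^{n-1}}.$$ Then $K^n=\{1\}\cup D$ if and only if $m_1$ and $m_2$ are positive integers, $$\chi(x)^n|K|^n=\chi(1)^{n-1}\bigl(m_1\chi(1)+m_2|D|\chi(d)\bigr)$$ for all $\chi\in\mathrm{Irr}(G)$, and $|K|^n=m_1+m_2|D|$.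
   Context: $x^G$ denotes the conjugacy class of $x$ in $G$; $K^n$ is the set of all products of $n$ elements of $K$; $\mathrm{Irr}(G)$ is the set of irreducible complex characters of $G$. $\mathbb{N}$ is the set of positive integers. *)

theory Defs
  imports
    Complex_Main
    "HOL-Algebra.Group_Action"
    "Jordan_Normal_Form.VS_Connect"
begin

definition conj_class :: "('a, 'b) monoid_scheme \<Rightarrow> 'a \<Rightarrow> 'a set" where
  "conj_class G x = orbit G (\<lambda>g. \<lambda>h\<in>carrier G. g \<otimes>\<^bsub>G\<^esub> h \<otimes>\<^bsub>G\<^esub> inv\<^bsub>G\<^esub> g) x"

primrec set_power :: "('a, 'b) monoid_scheme \<Rightarrow> 'a set \<Rightarrow> nat \<Rightarrow> 'a set" where
  "set_power G K 0 = {\<one>\<^bsub>G\<^esub>}"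
| "set_power G K (Suc n) = set_power G K n <#>\<^bsub>G\<^esub> K"

definition mat_trace :: "'a::comm_monoid_add mat \<Rightarrow> 'a" where
  "mat_trace A = (\<Sum>i<dim_row A. A $$ (i, i))"

(* The target group is GL_n(C). *)
definition complex_rep :: "('a, 'b) monoid_scheme \<Rightarrow> nat \<Rightarrow> ('a \<Rightarrow> complex mat) \<Rightarrow> bool" where
  "complex_rep G n \<rho> \<longleftrightarrow> \<rho> \<in> hom G (units_of (ring_mat TYPE(complex) n ()))"

definition irreducible_rep :: "('a, 'b) monoid_scheme \<Rightarrow> nat \<Rightarrow> ('a \<Rightarrow> complex mat) \<Rightarrow> bool" where
  "irreducible_rep G n \<rho> \<longleftrightarrow>
     complex_rep G n \<rho> \<and> n > 0 \<and>
     (\<forall>W. VectorSpace.subspace class_ring W (module_vec TYPE(complex) n) \<and>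
          (\<forall>g\<in>carrier G. \<forall>w\<in>W. \<rho> g *\<^sub>v w \<in> W)
        \<longrightarrow> W = {0\<^sub>v n} \<or> W = carrier_vec n)"

(* Characters are restricted to the carrier, so that two of them are equal as HOL
   functions iff they agree on G; otherwise the set Irr G could be infinite and sums over it
   would be 0 by convention. *)
definition rep_character :: "('a, 'b) monoid_scheme \<Rightarrow> ('a \<Rightarrow> complex mat) \<Rightarrow> 'a \<Rightarrow> complex" where
  "rep_character G \<rho> = (\<lambda>g\<in>carrier G. mat_trace (\<rho> g))"

definition Irr :: "('a, 'b) monoid_scheme \<Rightarrow> ('a \<Rightarrow> complex) set" where
  "Irr G = {rep_character G \<rho> | n \<rho>. irreducible_rep G n \<rho>}"

end

theory Submission
  imports Defs "Jordan_Normal_Form.Spectral_Radius" "HOL-Algebra.Multiplicative_Group"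
begin

text \<open>Let \<open>N g\<close> be the number of ways to write \<open>g\<close> as a product of \<open>n\<close> elements of \<open>K\<close>. Since the sum of
  \<open>K\<close> acts on an irreducible representation as the scalar \<open>|K| \<chi> x / \<chi> 1\<close>, we have
  \<open>\<Sum>g. N g * \<chi> g = \<chi> 1 * (|K| \<chi> x / \<chi> 1) ^ n\<close>; expanding the class function \<open>N\<close> in the orthogonal basis of
  irreducible characters gives Frobenius' formula for \<open>N g\<close>, hence \<open>m1 = N 1\<close> and \<open>m2 = N d\<close>.
  The total \<open>\<Sum>g. N g = |K| ^ n\<close> equals \<open>m1 + m2 * |D|\<close> iff \<open>N\<close> vanishes outside \<open>{1} \<union> D\<close>, and in
  that case the character identity is the displayed sum.

  A class function orthogonal to all irreducible characters is zero: every representation is block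
  triangular with smaller blocks or irreducible, so the orthogonality passes to the trace of
  the regular representation. No unitarity and no complete reducibility are needed.\<close>

section \<open>Traces and sums of matrices\<close>

text \<open>Complex conjugates enter without an invariant inner product: in a finite group
  \<open>\<rho> (inv g)\<close> is a power of \<open>\<rho> g\<close>, whose eigenvalues are roots
  of unity, so the trace at \<open>inv g\<close> is the conjugate of the trace at \<open>g\<close>.
  Sums over \<open>Irr G\<close> are meaningful only once \<open>Irr G\<close> is known to be
  finite. The expansion of class functions depends on this, so finiteness has to be derived before
  it, from row orthogonality. To get from orthogonality to a single value \<open>f g\<close>, the
  class function is translated to \<open>h \<mapsto> f (g \<otimes> h)\<close>. This is in general
  no class function, but it stays orthogonal to every irreducible character, because the sum of the
  \<open>f h \<cdot>\<^sub>m \<rho> h\<close> is a scalar matrix; the regular character then picks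
  out its value at the identity.\<close>

lemma mult_mat_index:
  assumes "A \<in> carrier_mat k n" "B \<in> carrier_mat n m" "i < k" "j < m"
  shows "(A * B) $$ (i, j) = (\<Sum>l<n. A $$ (i, l) * B $$ (l, j))"
  using assms by (auto simp: scalar_prod_def atLeast0LessThan)

lemma mat_trace_mult:
  assumes "A \<in> carrier_mat n m" "B \<in> carrier_mat m n"
  shows "mat_trace (A * B) = (\<Sum>i<n. \<Sum>j<m. A $$ (i, j) * B $$ (j, i))"
  using assms by (auto simp: mat_trace_def scalar_prod_def atLeast0LessThan)

lemma mat_trace_comm:
  fixes A B :: "'a::comm_semiring_0 mat"
  assumes "A \<in> carrier_mat n m" "B \<in> carrier_mat m n"
  shows "mat_trace (A * B) = mat_trace (B * A)"
  by (simp add: mat_trace_mult[OF assms] mat_trace_mult[OF assms(2,1)] sum.swap[of _ "{..<n}"] mult.commute)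

lemma mat_trace_one [simp]: "mat_trace (1\<^sub>m n) = of_nat n"
  by (simp add: mat_trace_def)

lemma mat_trace_smult: "mat_trace (c \<cdot>\<^sub>m A) = c * mat_trace A" if "A \<in> carrier_mat n n"
  for A :: "'a::comm_semiring_0 mat"
  using that by (auto simp: mat_trace_def sum_distrib_left)

lemma mat_trace_similar:
  fixes A :: "'a::comm_ring_1 mat"
  assumes "A \<in> carrier_mat n n" "P \<in> carrier_mat n n" "Q \<in> carrier_mat n n" "P * Q = 1\<^sub>m n"
  shows "mat_trace (Q * A * P) = mat_trace A"
proof -
  have "mat_trace (Q * A * P) = mat_trace (P * (Q * A))"
    using assms by (intro mat_trace_comm[of _ n n]) auto
  also have "P * (Q * A) = P * Q * A" using assms by (simp add: assoc_mult_mat[of P n n Q n A n, symmetric])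
  finally show ?thesis using assms by (simp only: left_mult_one_mat)
qed

text \<open>Matrices of all sizes share one type, so there is no single zero matrix to start a sum
  from. The dimensions are therefore passed explicitly and the summation is done entrywise.\<close>

definition msum :: "nat \<Rightarrow> nat \<Rightarrow> 's set \<Rightarrow> ('s \<Rightarrow> 'a::comm_ring_1 mat) \<Rightarrow> 'a mat" where
  "msum n m S F = mat n m (\<lambda>ij. \<Sum>s\<in>S. F s $$ ij)"

lemma msum_carrier [simp]: "msum n m S F \<in> carrier_mat n m"
  by (simp add: msum_def)

lemma msum_cong:
  assumes "\<And>s. s \<in> S \<Longrightarrow> F s = F' s"
  shows "msum n m S F = msum n m S F'"
  using assms by (auto simp: msum_def intro!: cong_mat sum.cong)

lemma msum_reindex:
  assumes "bij_betw h S T"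
  shows "msum n m T F = msum n m S (\<lambda>s. F (h s))"
  unfolding msum_def by (intro cong_mat refl sum.reindex_bij_betw[OF assms, symmetric])

lemma mult_msum:
  assumes A: "A \<in> carrier_mat k n" and F: "\<And>s. s \<in> S \<Longrightarrow> F s \<in> carrier_mat n m"
  shows "A * msum n m S F = msum k m S (\<lambda>s. A * F s)"
proof (rule eq_matI)
  fix i j assume "i < dim_row (msum k m S (\<lambda>s. A * F s))" "j < dim_col (msum k m S (\<lambda>s. A * F s))"
  then have ij: "i < k" "j < m" by (auto simp: msum_def)
  have "(A * msum n m S F) $$ (i, j) = (\<Sum>l<n. \<Sum>s\<in>S. A $$ (i, l) * F s $$ (l, j))"
    by (subst mult_mat_index[OF A msum_carrier ij], intro sum.cong refl)
      (simp add: msum_def sum_distrib_left ij)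
  also have "\<dots> = (\<Sum>s\<in>S. \<Sum>l<n. A $$ (i, l) * F s $$ (l, j))"
    by (rule sum.swap)
  also have "\<dots> = (\<Sum>s\<in>S. (A * F s) $$ (i, j))"
    by (intro sum.cong refl) (rule mult_mat_index[symmetric, OF A F ij])
  finally show "(A * msum n m S F) $$ (i, j) = msum k m S (\<lambda>s. A * F s) $$ (i, j)"
    using ij by (simp add: msum_def)
qed (use A in \<open>auto simp: msum_def\<close>)

lemma msum_mult:
  assumes A: "A \<in> carrier_mat m k" and F: "\<And>s. s \<in> S \<Longrightarrow> F s \<in> carrier_mat n m"
  shows "msum n m S F * A = msum n k S (\<lambda>s. F s * A)"
proof (rule eq_matI)
  fix i j assume "i < dim_row (msum n k S (\<lambda>s. F s * A))" "j < dim_col (msum n k S (\<lambda>s. F s * A))"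
  then have ij: "i < n" "j < k" by (auto simp: msum_def)
  have "(msum n m S F * A) $$ (i, j) = (\<Sum>l<m. \<Sum>s\<in>S. F s $$ (i, l) * A $$ (l, j))"
    by (subst mult_mat_index[OF msum_carrier A ij], intro sum.cong refl)
      (simp add: msum_def sum_distrib_right ij)
  also have "\<dots> = (\<Sum>s\<in>S. \<Sum>l<m. F s $$ (i, l) * A $$ (l, j))"
    by (rule sum.swap)
  also have "\<dots> = (\<Sum>s\<in>S. (F s * A) $$ (i, j))"
    by (intro sum.cong refl) (rule mult_mat_index[symmetric, OF F A ij])
  finally show "(msum n m S F * A) $$ (i, j) = msum n k S (\<lambda>s. F s * A) $$ (i, j)"
    using ij by (simp add: msum_def)
qed (use A in \<open>auto simp: msum_def\<close>)

lemma mat_trace_msum: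
  assumes "\<And>s. s \<in> S \<Longrightarrow> F s \<in> carrier_mat n n"
  shows "mat_trace (msum n n S F) = (\<Sum>s\<in>S. mat_trace (F s))"
proof -
  have "mat_trace (msum n n S F) = (\<Sum>i<n. \<Sum>s\<in>S. F s $$ (i, i))"
    by (simp add: mat_trace_def msum_def)
  also have "\<dots> = (\<Sum>s\<in>S. \<Sum>i<n. F s $$ (i, i))"
    by (rule sum.swap)
  also have "\<dots> = (\<Sum>s\<in>S. mat_trace (F s))"
    by (intro sum.cong refl) (use assms in \<open>force simp: mat_trace_def\<close>)
  finally show ?thesis .
qed

text \<open>The elementary matrix with a single entry 1, not the identity matrix. These are the test
  matrices for the trace form and for averaging over the group.\<close>

definition unit_mat :: "nat \<Rightarrow> nat \<Rightarrow> nat \<Rightarrow> nat \<Rightarrow> complex mat" where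
  "unit_mat n m i j = mat n m (\<lambda>(a, b). if a = i \<and> b = j then 1 else 0)"

lemma unit_mat_carrier [simp]: "unit_mat n m i j \<in> carrier_mat n m"
  by (simp add: unit_mat_def)

text \<open>Nondegeneracy of the trace form in explicit shape: if \<open>mat_trace (F * A)\<close>
  vanishes for all \<open>F\<close>, so does every entry of \<open>A\<close>.\<close>

lemma mat_trace_unit_mat_mult:
  assumes A: "A \<in> carrier_mat n m" and ij: "i < m" "j < n"
  shows "mat_trace (unit_mat m n i j * A) = A $$ (j, i)"
proof -
  have "mat_trace (unit_mat m n i j * A) = (\<Sum>a<m. \<Sum>b<n. unit_mat m n i j $$ (a, b) * A $$ (b, a))"
    by (rule mat_trace_mult[OF unit_mat_carrier A])
  also have "\<dots> = (\<Sum>a<m. if a = i then A $$ (j, a) else 0)"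
    using ij by (intro sum.cong refl) (auto simp: unit_mat_def if_distrib[of "\<lambda>x. x * _"] cong: if_cong)
  finally show ?thesis using ij by simp
qed

lemma mat_trace_unit_mat: "i < n \<Longrightarrow> j < n \<Longrightarrow> mat_trace (unit_mat n n i j) = (if i = j then 1 else 0)"
  using mat_trace_unit_mat_mult[of "1\<^sub>m n" n n i j] by (simp add: right_mult_one_mat[of _ n n] eq_commute)

text \<open>The product is column \<open>i\<close> of \<open>A\<close> times row \<open>j\<close> of
  \<open>B\<close>, so its entries factor. This separates the two representations in
  \<open>sum_character_product\<close>.\<close>

lemma mult_unit_mat_mult_index:
  assumes A: "A \<in> carrier_mat k n" and B: "B \<in> carrier_mat m l"
    and ij: "i < n" "j < m" and ab: "a < k" "b < l"
  shows "(A * unit_mat n m i j * B) $$ (a, b) = A $$ (a, i) * B $$ (j, b)"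
proof -
  have AE: "(A * unit_mat n m i j) $$ (a, d) = (if d = j then A $$ (a, i) else 0)" if "d < m" for d
  proof -
    have "(A * unit_mat n m i j) $$ (a, d) = (\<Sum>c<n. A $$ (a, c) * unit_mat n m i j $$ (c, d))"
      using ab that by (intro mult_mat_index[OF A unit_mat_carrier])
    also have "\<dots> = (\<Sum>c<n. if c = i then (if d = j then A $$ (a, c) else 0) else 0)"
      using that by (intro sum.cong) (auto simp: unit_mat_def)
    finally show ?thesis using ij by simp
  qed
  have "(A * unit_mat n m i j * B) $$ (a, b) = (\<Sum>d<m. (A * unit_mat n m i j) $$ (a, d) * B $$ (d, b))"
    using A B ab by (intro mult_mat_index[of _ k]) auto
  also have "\<dots> = (\<Sum>d<m. if d = j then A $$ (a, i) * B $$ (d, b) else 0)"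
    by (intro sum.cong) (auto simp: AE)
  finally show ?thesis using ij by simp
qed

section \<open>Triangular matrices and traces of matrices of finite order\<close>

lemma upper_triangular_mult:
  fixes A B :: "'a::comm_semiring_1 mat"
  assumes A: "A \<in> carrier_mat n n" "upper_triangular A" and B: "B \<in> carrier_mat n n" "upper_triangular B"
  shows "upper_triangular (A * B)" "\<And>i. i < n \<Longrightarrow> (A * B) $$ (i, i) = A $$ (i, i) * B $$ (i, i)"
proof -
  \<comment> \<open>A term of the matrix product survives only if \<open>i \<le> l \<le> j\<close>:
    no such \<open>l\<close> exists below the diagonal, and only \<open>l = i\<close> on it.\<close>
  have 0: "A $$ (i, l) * B $$ (l, j) = 0" if "i < n" "l < n" "l < i \<or> j < l" for i j l
    using that A B by (auto dest: upper_triangularD)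
  show "upper_triangular (A * B)"
  proof (rule upper_triangularI)
    fix i j assume ij: "j < i" "i < dim_row (A * B)"
    then have "(A * B) $$ (i, j) = (\<Sum>l<n. A $$ (i, l) * B $$ (l, j))"
      using A B by (intro mult_mat_index[of _ n n _ n]) auto
    also have "\<dots> = 0" using ij A by (intro sum.neutral ballI 0) auto
    finally show "(A * B) $$ (i, j) = 0" .
  qed
  fix i assume i: "i < n"
  have "(A * B) $$ (i, i) = (\<Sum>l<n. A $$ (i, l) * B $$ (l, i))"
    using A B i by (intro mult_mat_index[of _ n n _ n]) auto
  also have "\<dots> = (\<Sum>l<n. if l = i then A $$ (i, l) * B $$ (l, i) else 0)"
    by (intro sum.cong refl) (metis 0 i lessThan_iff linorder_neqE_nat)
  finally show "(A * B) $$ (i, i) = A $$ (i, i) * B $$ (i, i)" using i by simp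
qed

lemma upper_triangular_pow:
  fixes A :: "'a::comm_semiring_1 mat"
  assumes A: "A \<in> carrier_mat n n" "upper_triangular A"
  shows "upper_triangular (A ^\<^sub>m k) \<and> (\<forall>i<n. (A ^\<^sub>m k) $$ (i, i) = (A $$ (i, i)) ^ k)"
proof (induction k)
  case 0
  then show ?case using A by auto
next
  case (Suc k)
  have "A ^\<^sub>m k \<in> carrier_mat n n" using A by (intro pow_carrier_mat)
  then show ?case using Suc upper_triangular_mult[of "A ^\<^sub>m k" n A] A
    by (simp del: power_Suc add: power_Suc2)
qed

text \<open>Both sides are inverse to \<open>z\<close>: the left one because
  \<open>z ^ n = 1\<close>, the right one because \<open>z\<close> has norm 1.\<close>

lemma root_of_unity_cnj:
  fixes z :: complex
  assumes "z ^ n = 1" "n > 0"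
  shows "z ^ (n - 1) = cnj z"
proof -
  have "norm z ^ n = 1" using assms by (simp add: norm_power[symmetric])
  then have "norm z = 1" using assms(2) by (intro power_eq_imp_eq_base[of "norm z" n 1]) auto
  then have "z * cnj z = 1" by (simp add: complex_norm_square[symmetric])
  moreover have "z * z ^ (n - 1) = 1" using assms by (metis power_eq_if neq0_conv)
  ultimately show ?thesis by (metis mult_left_cancel mult_zero_left zero_neq_one)
qed

text \<open>Over the complex numbers \<open>A\<close> is similar to a triangular matrix, and
  \<open>A ^\<^sub>m k = 1\<^sub>m n\<close> makes its diagonal entries roots of unity. As
  \<open>A ^\<^sub>m (k - 1)\<close> is the inverse of \<open>A\<close>, this computes the trace of
  an inverse.\<close>

lemma mat_trace_pow_root_of_unity:
  fixes A :: "complex mat"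
  assumes A: "A \<in> carrier_mat n n" and k: "k > 0" "A ^\<^sub>m k = 1\<^sub>m n"
  shows "mat_trace (A ^\<^sub>m (k - 1)) = cnj (mat_trace A)"
proof -
  obtain as where "char_poly A = (\<Prod>a\<leftarrow>as. [:- a, 1:])" using char_poly_factorized[OF A] by auto
  then obtain B where B: "B \<in> carrier_mat n n" "upper_triangular B" and "similar_mat A B"
    using schur_decomposition_exists[OF A] by blast
  then obtain P Q where wit: "similar_mat_wit A B P Q" by (auto simp: similar_mat_def)
  then have P: "P \<in> carrier_mat n n" and Q: "Q \<in> carrier_mat n n" and PQ: "P * Q = 1\<^sub>m n" and QP: "Q * P = 1\<^sub>m n"
    using A by (auto simp: similar_mat_wit_def Let_def)
  note ut = upper_triangular_pow[OF B]
  have Bk: "B ^\<^sub>m j \<in> carrier_mat n n" for j using B by (intro pow_carrier_mat)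
  have trace: "mat_trace (A ^\<^sub>m j) = (\<Sum>i<n. (B $$ (i, i)) ^ j)" for j
  proof -
    have "mat_trace (A ^\<^sub>m j) = mat_trace (P * B ^\<^sub>m j * Q)"
      by (simp add: similar_mat_wit_pow_id[OF wit])
    also have "\<dots> = mat_trace (B ^\<^sub>m j)"
      by (rule mat_trace_similar[OF Bk Q P QP])
    also have "\<dots> = (\<Sum>i<n. (B $$ (i, i)) ^ j)"
      using ut Bk[of j] by (auto simp: mat_trace_def)
    finally show ?thesis .
  qed
  have "similar_mat_wit B A Q P"
    using wit by (rule similar_mat_wit_sym)
  then have "B ^\<^sub>m k = Q * A ^\<^sub>m k * P" by (rule similar_mat_wit_pow_id)
  then have "B ^\<^sub>m k = 1\<^sub>m n" using k Q P QP by simp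
  then have "(B $$ (i, i)) ^ k = 1" if "i < n" for i
    using ut[of k] that by (metis index_one_mat(1))
  then have "mat_trace (A ^\<^sub>m (k - 1)) = (\<Sum>i<n. cnj (B $$ (i, i)))"
    using k unfolding trace by (intro sum.cong refl root_of_unity_cnj) auto
  also have "\<dots> = cnj (mat_trace A)" using trace[of 1] A by simp
  finally show ?thesis .
qed

section \<open>Adapted bases\<close>

text \<open>The exchange matrix: multiplying \<open>P\<close> by it from the right replaces column
  \<open>j\<close> of \<open>P\<close> by \<open>P *\<^sub>v u\<close> and keeps the other
  columns.\<close>

definition subst_col :: "nat \<Rightarrow> nat \<Rightarrow> 'a vec \<Rightarrow> 'a::comm_ring_1 mat" where
  "subst_col n j u = mat n n (\<lambda>(a, b). if b = j then u $ a else if a = b then 1 else 0)"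

lemma subst_col_carrier [simp]: "subst_col n j u \<in> carrier_mat n n"
  by (simp add: subst_col_def)

text \<open>Columns other than \<open>j\<close> are already those of the identity. The two
  conditions on \<open>u\<close> and \<open>v\<close> say that column \<open>j\<close> of the
  product is the unit vector.\<close>

lemma subst_col_mult:
  fixes u v :: "'a::comm_ring_1 vec"
  assumes j: "j < n" and uv: "u $ j * v $ j = 1"
    and uv': "\<And>a. a < n \<Longrightarrow> a \<noteq> j \<Longrightarrow> u $ a * v $ j + v $ a = 0"
  shows "subst_col n j u * subst_col n j v = 1\<^sub>m n"
proof (rule eq_matI)
  fix a b assume "a < dim_row (1\<^sub>m n :: 'a mat)" "b < dim_col (1\<^sub>m n :: 'a mat)"
  then have ab: "a < n" "b < n" by auto
  let ?M = "\<lambda>a c. if c = j then u $ a else if a = c then 1 else 0"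
  let ?N = "\<lambda>c b. if b = j then v $ c else if c = b then 1 else 0"
  have eq: "(subst_col n j u * subst_col n j v) $$ (a, b) = (\<Sum>c<n. ?M a c * ?N c b)"
    using ab by (simp add: subst_col_def scalar_prod_def atLeast0LessThan)
  show "(subst_col n j u * subst_col n j v) $$ (a, b) = (1\<^sub>m n :: 'a mat) $$ (a, b)"
  proof (cases "b = j")
    case False
    then have "(\<Sum>c<n. ?M a c * ?N c b) = (\<Sum>c<n. if c = b then ?M a c else 0)"
      by (intro sum.cong) auto
    then show ?thesis using False ab eq by (simp)
  next
    case True
    have "(\<Sum>c<n. ?M a c * v $ c) = u $ a * v $ j + (\<Sum>c\<in>{..<n} - {j}. ?M a c * v $ c)"
      using j by (simp add: sum.remove[of "{..<n}" j])
    also have "(\<Sum>c\<in>{..<n} - {j}. ?M a c * v $ c) = (\<Sum>c\<in>{..<n} - {j}. if c = a then v $ c else 0)"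
      by (rule sum.cong) auto
    also have "\<dots> = (if a = j then 0 else v $ a)"
      using ab by (simp add: sum.delta)
    also have "u $ a * v $ j + \<dots> = (if a = j then 1 else 0)"
      using uv uv'[of a] ab by auto
    finally show ?thesis using eq True ab by simp
  qed
qed (simp_all add: subst_col_def)

lemma subst_col_inverse:
  fixes u :: "'a::field vec"
  assumes "j < n" "u $ j \<noteq> 0"
  obtains N where "N \<in> carrier_mat n n" "subst_col n j u * N = 1\<^sub>m n" "N * subst_col n j u = 1\<^sub>m n"
proof -
  \<comment> \<open>The solution of the two conditions in \<open>subst_col_mult\<close> for given
    \<open>u\<close>; it satisfies them with the roles of \<open>u\<close> and \<open>?v\<close>
    exchanged as well.\<close>
  let ?v = "vec n (\<lambda>a. if a = j then 1 / u $ j else - u $ a / u $ j)"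
  show thesis
  proof
    show "subst_col n j u * subst_col n j ?v = 1\<^sub>m n"
      using assms by (intro subst_col_mult) auto
    show "subst_col n j ?v * subst_col n j u = 1\<^sub>m n"
      using assms by (intro subst_col_mult) auto
  qed auto
qed

text \<open>\<open>P *\<^sub>v u\<close> is a linear combination of the columns of \<open>P\<close>
  in the support of \<open>u\<close>. The induction adds one column at a time and passes over those
  with coefficient zero.\<close>

lemma mult_mat_vec_in_subspace:
  fixes P :: "'a::comm_ring_1 mat"
  assumes W: "W \<subseteq> carrier_vec m" "0\<^sub>v m \<in> W"
    "\<And>v w. v \<in> W \<Longrightarrow> w \<in> W \<Longrightarrow> v + w \<in> W" "\<And>c v. v \<in> W \<Longrightarrow> c \<cdot>\<^sub>v v \<in> W"
    and P: "P \<in> carrier_mat m n" and u: "u \<in> carrier_vec n"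
    and cols: "\<And>j. j < n \<Longrightarrow> u $ j \<noteq> 0 \<Longrightarrow> col P j \<in> W"
  shows "P *\<^sub>v u \<in> W"
proof -
  have "vec m (\<lambda>i. \<Sum>j<k. P $$ (i, j) * u $ j) \<in> W" if "k \<le> n" for k
    using that
  proof (induction k)
    case 0
    have "vec m (\<lambda>i. 0) = (0\<^sub>v m :: 'a vec)" by auto
    then show ?case using W by simp
  next
    case (Suc k)
    have eq: "vec m (\<lambda>i. \<Sum>j<Suc k. P $$ (i, j) * u $ j)
      = vec m (\<lambda>i. \<Sum>j<k. P $$ (i, j) * u $ j) + u $ k \<cdot>\<^sub>v col P k"
      using P Suc by (intro eq_vecI) (auto simp: mult.commute)
    show ?case
    proof (cases "u $ k = 0")
      case True
      then show ?thesis using Suc by simp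
    next
      case False
      then show ?thesis unfolding eq using Suc W cols[of k] by simp
    qed
  qed
  moreover have "P *\<^sub>v u = vec m (\<lambda>i. \<Sum>j<n. P $$ (i, j) * u $ j)"
    using P u by (intro eq_vecI) (auto simp: scalar_prod_def atLeast0LessThan)
  ultimately show ?thesis by simp
qed

text \<open>Take an invertible matrix with as many columns in \<open>W\<close> as possible: if some \<open>w \<in> W\<close> had a nonzero
  coordinate at another column, replacing that column by \<open>w\<close> would contradict maximality.\<close>

lemma adapted_basis:
  fixes W :: "'a::field vec set"
  assumes W: "W \<subseteq> carrier_vec n"
  obtains J P Q where "J \<subseteq> {..<n}" "P \<in> carrier_mat n n" "Q \<in> carrier_mat n n"
    "P * Q = 1\<^sub>m n" "Q * P = 1\<^sub>m n" "\<And>j. j \<in> J \<Longrightarrow> col P j \<in> W"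
    "\<And>w i. w \<in> W \<Longrightarrow> i < n \<Longrightarrow> i \<notin> J \<Longrightarrow> (Q *\<^sub>v w) $ i = 0"
proof -
  define X where "X J P Q \<longleftrightarrow> J \<subseteq> {..<n} \<and> P \<in> carrier_mat n n \<and> Q \<in> carrier_mat n n \<and>
    P * Q = 1\<^sub>m n \<and> Q * P = 1\<^sub>m n \<and> (\<forall>j\<in>J. col P j \<in> W)" for J and P Q :: "'a mat"
  define Y where "Y k \<longleftrightarrow> (\<exists>J P Q. X J P Q \<and> card J = k)" for k
  have "X {} (1\<^sub>m n) (1\<^sub>m n)" by (simp add: X_def)
  then have "Y 0" unfolding Y_def by force
  moreover have bound: "k \<le> n" if "Y k" for k
  proof -
    from that obtain J P Q where "X J P Q" "card J = k" by (auto simp: Y_def)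
    then show ?thesis using card_mono[of "{..<n}" J] by (auto simp: X_def)
  qed
  ultimately obtain k where k: "Y k" "\<And>k'. Y k' \<Longrightarrow> k' \<le> k"
    using Nat.ex_has_greatest_nat[of Y 0 n] by blast
  then obtain J P Q where JPQ: "X J P Q" "card J = k" by (auto simp: Y_def)
  then have J: "J \<subseteq> {..<n}" and P: "P \<in> carrier_mat n n" and Q: "Q \<in> carrier_mat n n"
    and PQ: "P * Q = 1\<^sub>m n" and QP: "Q * P = 1\<^sub>m n" and cols: "\<And>j. j \<in> J \<Longrightarrow> col P j \<in> W"
    by (auto simp: X_def)
  have "(Q *\<^sub>v w) $ i = 0" if w: "w \<in> W" and i: "i < n" "i \<notin> J" for w i
  proof (rule ccontr)
    define u where "u = Q *\<^sub>v w"
    assume "(Q *\<^sub>v w) $ i \<noteq> 0"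
    then have "u $ i \<noteq> 0" by (simp add: u_def)
    from w W have wc: "w \<in> carrier_vec n" by auto
    then have u: "u \<in> carrier_vec n" using Q by (simp add: u_def)
    obtain N where N: "N \<in> carrier_mat n n" "subst_col n i u * N = 1\<^sub>m n" "N * subst_col n i u = 1\<^sub>m n"
      using subst_col_inverse[of i n u] i \<open>u $ i \<noteq> 0\<close> by blast
    \<comment> \<open>Since \<open>u\<close> holds the coordinates of \<open>w\<close>,
      \<open>P * M\<close> is \<open>P\<close> with column \<open>i\<close> replaced by
      \<open>w\<close>; its inverse is \<open>N * Q\<close>.\<close>
    define M where "M = subst_col n i u"
    have M: "M \<in> carrier_mat n n" "M * N = 1\<^sub>m n" "N * M = 1\<^sub>m n" using N by (auto simp: M_def)
    have colM: "col M j = (if j = i then u else unit_vec n j)" if "j < n" for j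
      using that u by (auto simp: M_def subst_col_def unit_vec_def intro!: eq_vecI)
    have col_PM: "col (P * M) j = P *\<^sub>v col M j" if "j < n" for j
      using that P M by (intro col_mult2) auto
    have "P * M * (N * Q) = P * (M * N * Q)"
      using P M(1) N(1) Q assoc_mult_mat[of _ n n _ n _ n] by (metis mult_carrier_mat)
    then have 1: "P * M * (N * Q) = 1\<^sub>m n" using M(2) Q PQ by simp
    have "N * Q * (P * M) = N * (Q * P * M)"
      using P M(1) N(1) Q assoc_mult_mat[of _ n n _ n _ n] by (metis mult_carrier_mat)
    then have 2: "N * Q * (P * M) = 1\<^sub>m n" using M QP by simp
    have "P *\<^sub>v u = (P * Q) *\<^sub>v w" using P Q wc by (simp add: u_def)
    then have Pu: "P *\<^sub>v u = w" using PQ wc by simp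
    have "col (P * M) j \<in> W" if "j \<in> insert i J" for j
    proof (cases "j = i")
      case True
      then show ?thesis using col_PM[of j] colM[of j] i Pu w by simp
    next
      case False
      then have j: "j \<in> J" "j < n" using that J by auto
      then have "col (P * M) j = P *\<^sub>v unit_vec n j" using col_PM[of j] colM[of j] False by simp
      also have "\<dots> = col P j" using P j(2) by (intro eq_vecI) auto
      finally show ?thesis using cols j by simp
    qed
    then have "X (insert i J) (P * M) (N * Q)"
      using J i P M N Q 1 2 by (auto simp: X_def)
    moreover have "card (insert i J) = Suc k"
      using JPQ i J finite_subset[OF J] by simp
    ultimately have "Y (Suc k)" by (auto simp: Y_def)
    then show False using k(2) by fastforce
  qed
  then show thesis using that J P Q PQ QP cols by blast
qed

section \<open>Irreducible representations and their characters\<close>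

locale finite_group = group G for G (structure) +
  assumes finite_carrier: "finite (carrier G)"
begin

text \<open>Invertibility is implicit on the right: once products and the identity are respected,
  \<open>\<rho> (inv g)\<close> is a two-sided inverse of \<open>\<rho> g\<close>.\<close>

lemma complex_rep_iff:
  "complex_rep G n \<rho> \<longleftrightarrow> (\<forall>g\<in>carrier G. \<rho> g \<in> carrier_mat n n) \<and>
     (\<forall>g\<in>carrier G. \<forall>h\<in>carrier G. \<rho> (g \<otimes> h) = \<rho> g * \<rho> h) \<and> \<rho> \<one> = 1\<^sub>m n" (is "?L \<longleftrightarrow> ?R")
proof
  assume L: ?L
  interpret R: ring "ring_mat TYPE(complex) n ()" by (rule ring_mat)
  interpret H: group "units_of (ring_mat TYPE(complex) n ())" by (rule R.units_group)
  interpret group_hom G "units_of (ring_mat TYPE(complex) n ())" \<rho>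
    by unfold_locales (use L in \<open>simp add: complex_rep_def\<close>)
  have *: "\<rho> g \<in> Units (ring_mat TYPE(complex) n ())" if "g \<in> carrier G" for g
    using hom_closed[OF that] by (simp add: units_of_carrier)
  show ?R
    using * R.Units_closed hom_mult hom_one
    by (auto simp: units_of_mult units_of_one ring_mat_simps)
next
  assume R: ?R
  have "\<rho> g \<in> Units (ring_mat TYPE(complex) n ())" if g: "g \<in> carrier G" for g
  proof -
    have "\<rho> g * \<rho> (inv g) = 1\<^sub>m n" "\<rho> (inv g) * \<rho> g = 1\<^sub>m n"
      using R g by (metis inv_closed r_inv l_inv)+
    then show ?thesis
      using R g by (auto simp: Units_def ring_mat_simps intro!: bexI[of _ "\<rho> (inv g)"])
  qed
  then show ?L
    using R by (auto simp: complex_rep_def hom_def units_of_carrier units_of_mult ring_mat_simps)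
qed

lemma complex_repD:
  assumes "complex_rep G n \<rho>"
  shows "g \<in> carrier G \<Longrightarrow> \<rho> g \<in> carrier_mat n n"
    and "g \<in> carrier G \<Longrightarrow> h \<in> carrier G \<Longrightarrow> \<rho> (g \<otimes> h) = \<rho> g * \<rho> h"
    and "\<rho> \<one> = 1\<^sub>m n"
  using assms by (auto simp: complex_rep_iff)

lemma subspace_iff:
  "VectorSpace.subspace class_ring W (module_vec TYPE(complex) n) \<longleftrightarrow>
     W \<subseteq> carrier_vec n \<and> 0\<^sub>v n \<in> W \<and> (\<forall>v\<in>W. \<forall>w\<in>W. v + w \<in> W) \<and> (\<forall>c. \<forall>v\<in>W. c \<cdot>\<^sub>v v \<in> W)"
  using vec_module[where ?'a = complex, of n] vec_vs[where ?'a = complex, of n]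
  by (auto simp: VectorSpace.subspace_def submodule_def module_vec_simps)

text \<open>Because \<open>n > 0\<close>, \<open>A\<close> has a complex eigenvalue. Its eigenspace
  is nonzero, and invariant because \<open>A\<close> commutes with the representation, so
  irreducibility makes it the whole space.\<close>

lemma schur:
  assumes irr: "irreducible_rep G n \<rho>" and A: "A \<in> carrier_mat n n"
    and comm: "\<And>g. g \<in> carrier G \<Longrightarrow> A * \<rho> g = \<rho> g * A"
  obtains c where "A = c \<cdot>\<^sub>m 1\<^sub>m n"
proof -
  have rep: "complex_rep G n \<rho>" and n: "n > 0" using irr by (auto simp: irreducible_rep_def)
  note rho = complex_repD[OF rep]
  obtain c where "eigenvalue A c"
    using spectrum_non_empty[OF A n] by (auto simp: spectrum_def)
  then obtain v where v: "v \<in> carrier_vec n" "v \<noteq> 0\<^sub>v n" "A *\<^sub>v v = c \<cdot>\<^sub>v v"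
    using A by (auto simp: eigenvalue_def eigenvector_def)
  define W where "W = {w \<in> carrier_vec n. A *\<^sub>v w = c \<cdot>\<^sub>v w}"
  have "VectorSpace.subspace class_ring W (module_vec TYPE(complex) n)"
    unfolding subspace_iff using A
    by (auto simp: W_def mult_add_distrib_mat_vec smult_add_distrib_vec mult_mat_vec smult_smult_assoc
        mult.commute)
  moreover have "\<rho> g *\<^sub>v w \<in> W" if g: "g \<in> carrier G" and w: "w \<in> W" for g w
  proof -
    have wc: "w \<in> carrier_vec n" using w by (simp add: W_def)
    have "A *\<^sub>v (\<rho> g *\<^sub>v w) = (A * \<rho> g) *\<^sub>v w"
      using A rho(1)[OF g] wc by (simp add: assoc_mult_mat_vec)
    also have "\<dots> = \<rho> g *\<^sub>v (A *\<^sub>v w)"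
      using A rho(1)[OF g] wc by (simp add: comm[OF g] assoc_mult_mat_vec)
    also have "\<dots> = c \<cdot>\<^sub>v (\<rho> g *\<^sub>v w)"
      using w rho(1)[OF g] by (simp add: W_def mult_mat_vec)
    finally show ?thesis using rho(1)[OF g] wc by (simp add: W_def)
  qed
  moreover have "W \<noteq> {0\<^sub>v n}" using v by (auto simp: W_def)
  ultimately have W: "W = carrier_vec n"
    using irr by (auto simp: irreducible_rep_def)
  have "A = c \<cdot>\<^sub>m 1\<^sub>m n"
  proof (rule mat_col_eqI)
    fix j assume "j < dim_col (c \<cdot>\<^sub>m 1\<^sub>m n)"
    then have j: "j < n" by simp
    have "A *\<^sub>v unit_vec n j = c \<cdot>\<^sub>v unit_vec n j"
      using W unit_vec_carrier[of n j] unfolding W_def by blast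
    moreover have "A *\<^sub>v unit_vec n j = col A j"
      using A j by (intro eq_vecI) auto
    ultimately show "col A j = col (c \<cdot>\<^sub>m 1\<^sub>m n) j"
      using j by simp
  qed (use A in auto)
  then show thesis by (rule that)
qed

section \<open>Translations, inversion and conjugation as bijections of the group\<close>

lemma mult_inv_cancel:
  assumes "g \<in> carrier G" "x \<in> carrier G"
  shows "g \<otimes> (inv g \<otimes> x) = x" "inv g \<otimes> (g \<otimes> x) = x"
  using assms by (simp_all add: m_assoc[symmetric])

lemma bij_mult_left: "g \<in> carrier G \<Longrightarrow> bij_betw (\<lambda>x. g \<otimes> x) (carrier G) (carrier G)"
  by (rule bij_betw_byWitness[of _ "\<lambda>x. inv g \<otimes> x"]) (auto simp: m_assoc[symmetric])

lemma bij_mult_right: "g \<in> carrier G \<Longrightarrow> bij_betw (\<lambda>x. x \<otimes> g) (carrier G) (carrier G)"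
  by (rule bij_betw_byWitness[of _ "\<lambda>x. x \<otimes> inv g"]) (auto simp: m_assoc)

lemma bij_inv: "bij_betw (\<lambda>x. inv x) (carrier G) (carrier G)"
  by (rule bij_betw_byWitness[of _ "\<lambda>x. inv x"]) auto

lemma bij_conj: "g \<in> carrier G \<Longrightarrow> bij_betw (\<lambda>x. g \<otimes> x \<otimes> inv g) (carrier G) (carrier G)"
  by (rule bij_betw_byWitness[of _ "\<lambda>x. inv g \<otimes> x \<otimes> g"])
    (auto simp: m_assoc mult_inv_cancel)

text \<open>The standard way to turn an arbitrary matrix into an intertwiner from
  \<open>\<sigma>\<close> to \<open>\<rho>\<close>. There is no division by the group order, which
  therefore appears in \<open>mat_trace_average\<close>.\<close>

definition average :: "nat \<Rightarrow> nat \<Rightarrow> ('a \<Rightarrow> complex mat) \<Rightarrow> ('a \<Rightarrow> complex mat) \<Rightarrow> complex mat \<Rightarrow> complex mat" where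
  "average n m \<rho> \<sigma> E = msum n m (carrier G) (\<lambda>g. \<rho> (inv g) * E * \<sigma> g)"

lemma average_carrier [simp]: "average n m \<rho> \<sigma> E \<in> carrier_mat n m"
  by (simp add: average_def)

text \<open>Substitute \<open>g \<otimes> h\<close> for \<open>g\<close>: then
  \<open>\<sigma> h\<close> is absorbed on the right, while
  \<open>\<rho> (inv g) = \<rho> h * \<rho> (inv (g \<otimes> h))\<close> releases
  \<open>\<rho> h\<close> on the left.\<close>

lemma average_intertwines:
  assumes rho: "complex_rep G n \<rho>" and sigma: "complex_rep G m \<sigma>"
    and E: "E \<in> carrier_mat n m" and h: "h \<in> carrier G"
  shows "average n m \<rho> \<sigma> E * \<sigma> h = \<rho> h * average n m \<rho> \<sigma> E"
proof -
  note r = complex_repD[OF rho] and s = complex_repD[OF sigma]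
  have car: "\<rho> (inv g) * E * \<sigma> g \<in> carrier_mat n m" if "g \<in> carrier G" for g
    using that r(1)[of "inv g"] s(1)[of g] E by auto
  have "average n m \<rho> \<sigma> E * \<sigma> h = msum n m (carrier G) (\<lambda>g. \<rho> (inv g) * E * \<sigma> g * \<sigma> h)"
    unfolding average_def by (rule msum_mult[OF s(1)[OF h] car])
  also have "\<dots> = msum n m (carrier G) (\<lambda>g. \<rho> h * (\<rho> (inv (g \<otimes> h)) * E * \<sigma> (g \<otimes> h)))"
  proof (rule msum_cong)
    fix g assume g: "g \<in> carrier G"
    have "\<rho> (inv g) = \<rho> h * \<rho> (inv (g \<otimes> h))"
      using g h by (simp add: r(2)[symmetric] inv_mult_group m_assoc[symmetric])
    then have "\<rho> (inv g) * E * \<sigma> g * \<sigma> h = \<rho> h * \<rho> (inv (g \<otimes> h)) * E * (\<sigma> g * \<sigma> h)"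
      using r(1)[of "inv g"] s(1) g h E by (subst assoc_mult_mat[of _ n m _ m _ m]) auto
    also have "\<dots> = \<rho> h * \<rho> (inv (g \<otimes> h)) * E * \<sigma> (g \<otimes> h)"
      using g h by (simp add: s(2))
    also have "\<dots> = \<rho> h * (\<rho> (inv (g \<otimes> h)) * E) * \<sigma> (g \<otimes> h)"
      using r(1)[OF h] r(1)[of "inv (g \<otimes> h)"] g h E by (subst assoc_mult_mat[of _ n n _ n _ m]) auto
    also have "\<dots> = \<rho> h * (\<rho> (inv (g \<otimes> h)) * E * \<sigma> (g \<otimes> h))"
      using r(1)[OF h] r(1)[of "inv (g \<otimes> h)"] s(1)[of "g \<otimes> h"] g h E by (intro assoc_mult_mat[of _ n n _ m _ m]) auto
    finally show "\<rho> (inv g) * E * \<sigma> g * \<sigma> h = \<rho> h * (\<rho> (inv (g \<otimes> h)) * E * \<sigma> (g \<otimes> h))" .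
  qed
  also have "\<dots> = msum n m (carrier G) (\<lambda>g. \<rho> h * (\<rho> (inv g) * E * \<sigma> g))"
    by (rule msum_reindex[OF bij_mult_right[OF h], symmetric])
  also have "\<dots> = \<rho> h * average n m \<rho> \<sigma> E"
    unfolding average_def by (rule mult_msum[OF r(1)[OF h] car, symmetric])
  finally show ?thesis .
qed

text \<open>Every summand is conjugate to \<open>E\<close> and has the same trace.\<close>

lemma mat_trace_average:
  assumes rho: "complex_rep G n \<rho>" and E: "E \<in> carrier_mat n n"
  shows "mat_trace (average n n \<rho> \<rho> E) = of_nat (card (carrier G)) * mat_trace E"
proof -
  note r = complex_repD[OF rho]
  have "mat_trace (average n n \<rho> \<rho> E) = (\<Sum>g\<in>carrier G. mat_trace (\<rho> (inv g) * E * \<rho> g))"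
    unfolding average_def
  proof (rule mat_trace_msum)
    fix g assume g: "g \<in> carrier G"
    show "\<rho> (inv g) * E * \<rho> g \<in> carrier_mat n n"
      using r(1)[of "inv g"] r(1)[OF g] g E by simp
  qed
  also have "\<dots> = (\<Sum>g\<in>carrier G. mat_trace E)"
  proof (rule sum.cong[OF refl])
    fix g assume g: "g \<in> carrier G"
    have "\<rho> g * \<rho> (inv g) = 1\<^sub>m n" using g by (simp add: r(2)[symmetric] r(3))
    then show "mat_trace (\<rho> (inv g) * E * \<rho> g) = mat_trace E"
      using g r(1) E by (intro mat_trace_similar) auto
  qed
  finally show ?thesis by simp
qed

text \<open>By \<open>schur\<close> the average is a scalar matrix, and its trace determines the
  scalar.\<close>

lemma average_irreducible:
  assumes irr: "irreducible_rep G n \<rho>" and E: "E \<in> carrier_mat n n"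
  shows "average n n \<rho> \<rho> E = (of_nat (card (carrier G)) * mat_trace E / of_nat n) \<cdot>\<^sub>m 1\<^sub>m n"
proof -
  have rho: "complex_rep G n \<rho>" and n: "n > 0" using irr by (auto simp: irreducible_rep_def)
  obtain c where c: "average n n \<rho> \<rho> E = c \<cdot>\<^sub>m 1\<^sub>m n"
    using schur[OF irr average_carrier average_intertwines[OF rho rho E]] by metis
  have "of_nat (card (carrier G)) * mat_trace E = c * of_nat n"
    using mat_trace_average[OF rho E] unfolding c by (simp add: mat_trace_smult[of _ n])
  then show ?thesis using c n by (simp add: field_simps)
qed

section \<open>Degrees of irreducible characters and values at inverses\<close>

lemma card_carrier_pos: "card (carrier G) > 0"
  using finite_carrier by (auto simp: card_gt_0_iff)

lemma IrrE:
  assumes "\<chi> \<in> Irr G"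
  obtains n \<rho> where "irreducible_rep G n \<rho>" "complex_rep G n \<rho>" "n > 0"
    "\<And>g. g \<in> carrier G \<Longrightarrow> \<chi> g = mat_trace (\<rho> g)" "\<chi> \<one> = of_nat n" "\<chi> = rep_character G \<rho>"
proof -
  from assms obtain n \<rho> where \<rho>: "irreducible_rep G n \<rho>" "\<chi> = rep_character G \<rho>" by (auto simp: Irr_def)
  then have "complex_rep G n \<rho>" "n > 0" by (auto simp: irreducible_rep_def)
  moreover have "\<chi> \<one> = of_nat n"
    using \<rho> complex_repD(3)[OF \<open>complex_rep G n \<rho>\<close>] by (simp add: rep_character_def)
  ultimately show thesis using that \<rho> by (auto simp: rep_character_def)
qed

lemma complex_rep_pow:
  assumes "complex_rep G n \<rho>" "g \<in> carrier G"
  shows "\<rho> (g [^] (k::nat)) = \<rho> g ^\<^sub>m k"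
proof (induction k)
  case 0
  then show ?case using complex_repD[OF assms(1)] assms(2) by auto
next
  case (Suc k)
  then show ?case using complex_repD[OF assms(1)] assms(2) by simp
qed

text \<open>With \<open>N\<close> the group order, \<open>inv g = g [^] (N - 1)\<close> and
  \<open>\<rho> g\<close> has \<open>N\<close>-th power 1, so the result on matrices of finite order
  applies.\<close>

lemma mat_trace_rep_inv:
  assumes rep: "complex_rep G n \<rho>" and g: "g \<in> carrier G"
  shows "mat_trace (\<rho> (inv g)) = cnj (mat_trace (\<rho> g))"
proof -
  let ?N = "card (carrier G)"
  have N: "g [^] ?N = \<one>" using pow_order_eq_1[OF g] by (simp add: Coset.order_def)
  then have "g [^] (?N - 1) \<otimes> g = \<one>"
    using g card_carrier_pos by (metis Suc_diff_1 nat_pow_Suc)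
  then have "inv g = g [^] (?N - 1)"
    using g by (intro inv_equality) auto
  moreover have "\<rho> g ^\<^sub>m ?N = 1\<^sub>m n"
    using complex_rep_pow[OF rep g, of ?N] N complex_repD(3)[OF rep] by simp
  ultimately show ?thesis
    using mat_trace_pow_root_of_unity[OF complex_repD(1)[OF rep g] card_carrier_pos]
      complex_rep_pow[OF rep g] by simp
qed

lemma Irr_inv: "\<chi> \<in> Irr G \<Longrightarrow> g \<in> carrier G \<Longrightarrow> \<chi> (inv g) = cnj (\<chi> g)"
  by (elim IrrE) (simp add: mat_trace_rep_inv)

text \<open>Two intertwiners \<open>A\<close>, \<open>B\<close> in opposite directions satisfy \<open>B A = c\<close> and \<open>A B = c\<close> by Schur's lemma.
  If \<open>c \<noteq> 0\<close> the characters agree; otherwise the trace of \<open>B A\<close> vanishes, and averaging over all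
  choices of \<open>B\<close> forces \<open>A = 0\<close>.\<close>

lemma average_distinct:
  assumes irr1: "irreducible_rep G n \<rho>" and irr2: "irreducible_rep G m \<sigma>"
    and neq: "rep_character G \<rho> \<noteq> rep_character G \<sigma>" and E: "E \<in> carrier_mat n m"
  shows "average n m \<rho> \<sigma> E = 0\<^sub>m n m"
proof (rule ccontr)
  assume A0: "average n m \<rho> \<sigma> E \<noteq> 0\<^sub>m n m"
  have rho: "complex_rep G n \<rho>" and sigma: "complex_rep G m \<sigma>" and m: "m > 0"
    using irr1 irr2 by (auto simp: irreducible_rep_def)
  note r = complex_repD[OF rho] and s = complex_repD[OF sigma]
  define A where "A = average n m \<rho> \<sigma> E"
  have A: "A \<in> carrier_mat n m" by (simp add: A_def)
  have Acomm: "A * \<sigma> h = \<rho> h * A" if "h \<in> carrier G" for h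
    unfolding A_def by (rule average_intertwines[OF rho sigma E that])
  have trace0: "mat_trace (F * A) = 0" if F: "F \<in> carrier_mat m n" for F
  proof -
    define B where "B = average m n \<sigma> \<rho> F"
    have B: "B \<in> carrier_mat m n" by (simp add: B_def)
    have Bcomm: "B * \<rho> h = \<sigma> h * B" if "h \<in> carrier G" for h
      unfolding B_def by (rule average_intertwines[OF sigma rho F that])
    have "B * A * \<sigma> h = \<sigma> h * (B * A)" if h: "h \<in> carrier G" for h
      using assoc_mult_mat[OF B A s(1)[OF h]] assoc_mult_mat[OF B r(1)[OF h] A]
        assoc_mult_mat[OF s(1)[OF h] B A] Acomm[OF h] Bcomm[OF h] by simp
    then obtain c where c: "B * A = c \<cdot>\<^sub>m 1\<^sub>m m"
      using schur[OF irr2, of "B * A"] A B by (metis mult_carrier_mat)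
    have "A * B * \<rho> h = \<rho> h * (A * B)" if h: "h \<in> carrier G" for h
      using assoc_mult_mat[OF A B r(1)[OF h]] assoc_mult_mat[OF A s(1)[OF h] B]
        assoc_mult_mat[OF r(1)[OF h] A B] Acomm[OF h] Bcomm[OF h] by simp
    then obtain c' where c': "A * B = c' \<cdot>\<^sub>m 1\<^sub>m n"
      using schur[OF irr1, of "A * B"] A B by (metis mult_carrier_mat)
    \<comment> \<open>Bracketing \<open>A * B * A\<close> in two ways identifies the two scalars,
      since \<open>A\<close> has a nonzero entry.\<close>
    have "c \<cdot>\<^sub>m A = c' \<cdot>\<^sub>m A"
      using assoc_mult_mat[OF A B A] A unfolding c c'
      by (simp add: mult_smult_distrib[of _ n m _ m] mult_smult_assoc_mat[of _ n n _ m])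
    moreover obtain i j where "i < n" "j < m" "A $$ (i, j) \<noteq> 0"
      using A0 A unfolding A_def[symmetric] by (metis carrier_matD(1,2) eq_matI index_zero_mat)
    ultimately have "c' = c"
      using A by (metis carrier_matD(1,2) index_smult_mat(1) mult_right_cancel)
    have "c = 0"
    proof (rule ccontr)
      assume "c \<noteq> 0"
      \<comment> \<open>Move \<open>B\<close> past \<open>\<sigma> g\<close> and use the cyclic
        invariance of the trace: this compares \<open>c\<close> times one character with
        \<open>c\<close> times the other.\<close>
      have "mat_trace (\<rho> g) = mat_trace (\<sigma> g)" if g: "g \<in> carrier G" for g
      proof -
        have "c * mat_trace (\<sigma> g) = mat_trace (\<sigma> g * (B * A))"
          using s(1)[OF g] by (simp add: c mult_smult_distrib[of _ m m _ m] mat_trace_smult[of _ m])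
        also have "\<sigma> g * (B * A) = B * \<rho> g * A"
          using assoc_mult_mat[OF s(1)[OF g] B A] Bcomm[OF g] by simp
        also have "mat_trace (B * \<rho> g * A) = mat_trace (A * (B * \<rho> g))"
          using A B r(1)[OF g] by (intro mat_trace_comm[of _ m n]) auto
        also have "A * (B * \<rho> g) = c \<cdot>\<^sub>m \<rho> g"
          using assoc_mult_mat[OF A B r(1)[OF g]] c' \<open>c' = c\<close> r(1)[OF g]
          by (simp add: mult_smult_assoc_mat[of _ n n _ n])
        also have "mat_trace (c \<cdot>\<^sub>m \<rho> g) = c * mat_trace (\<rho> g)"
          by (rule mat_trace_smult[OF r(1)[OF g]])
        finally show ?thesis using \<open>c \<noteq> 0\<close> by simp
      qed
      then show False using neq by (auto simp: rep_character_def restrict_def)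
    qed
    \<comment> \<open>Pulling \<open>A\<close> through \<open>\<rho> g\<close> inside the sum shows
      that \<open>B * A\<close> is itself an average, so its trace is the group order times that of
      \<open>F * A\<close>.\<close>
    have "B * A = average m m \<sigma> \<sigma> (F * A)"
    proof -
      have car: "\<sigma> (inv g) * F * \<rho> g \<in> carrier_mat m n" if "g \<in> carrier G" for g
        using that s(1)[of "inv g"] r(1)[of g] F by auto
      have "B * A = msum m m (carrier G) (\<lambda>g. \<sigma> (inv g) * F * \<rho> g * A)"
        unfolding B_def average_def by (rule msum_mult[OF A car])
      also have "\<dots> = msum m m (carrier G) (\<lambda>g. \<sigma> (inv g) * (F * A) * \<sigma> g)"
      proof (rule msum_cong)
        fix g assume g: "g \<in> carrier G"
        have si: "\<sigma> (inv g) \<in> carrier_mat m m" using g by (intro s) auto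
        have "\<sigma> (inv g) * F * \<rho> g * A = \<sigma> (inv g) * F * (A * \<sigma> g)"
          using assoc_mult_mat[of "\<sigma> (inv g) * F" m n "\<rho> g" n A m] si F r(1)[OF g] A Acomm[OF g] by simp
        also have "\<dots> = \<sigma> (inv g) * F * A * \<sigma> g"
          using assoc_mult_mat[of "\<sigma> (inv g) * F" m n A m "\<sigma> g" m] si F s(1)[OF g] A by simp
        also have "\<sigma> (inv g) * F * A = \<sigma> (inv g) * (F * A)"
          by (rule assoc_mult_mat[OF si F A])
        finally show "\<sigma> (inv g) * F * \<rho> g * A = \<sigma> (inv g) * (F * A) * \<sigma> g" .
      qed
      finally show ?thesis by (simp add: average_def)
    qed
    then have "of_nat (card (carrier G)) * mat_trace (F * A) = mat_trace (B * A)"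
      using mat_trace_average[OF sigma, of "F * A"] F A by simp
    also have "\<dots> = 0" using c \<open>c = 0\<close> by (simp add: mat_trace_smult[of _ m])
    finally show ?thesis using card_carrier_pos by simp
  qed
  have "A = 0\<^sub>m n m"
  proof (rule eq_matI)
    fix i j assume "i < dim_row (0\<^sub>m n m)" "j < dim_col (0\<^sub>m n m)"
    then have ij: "i < n" "j < m" by auto
    then show "A $$ (i, j) = 0\<^sub>m n m $$ (i, j)"
      using mat_trace_unit_mat_mult[OF A, of j i] trace0[of "unit_mat m n j i"] by simp
  qed (use A in auto)
  then show False using A0 by (simp add: A_def)
qed

text \<open>Expand both traces along their diagonals:
  \<open>\<rho> (inv g) $$ (i, i) * \<sigma> g $$ (j, j)\<close> is the \<open>(i, j)\<close> entry
  of \<open>\<rho> (inv g) * unit_mat n m i j * \<sigma> g\<close>.\<close>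

lemma sum_character_product:
  assumes rho: "complex_rep G n \<rho>" and sigma: "complex_rep G m \<sigma>"
  shows "(\<Sum>g\<in>carrier G. mat_trace (\<rho> (inv g)) * mat_trace (\<sigma> g))
    = (\<Sum>i<n. \<Sum>j<m. average n m \<rho> \<sigma> (unit_mat n m i j) $$ (i, j))"
proof -
  note r = complex_repD[OF rho] and s = complex_repD[OF sigma]
  have "(\<Sum>i<n. \<Sum>j<m. average n m \<rho> \<sigma> (unit_mat n m i j) $$ (i, j))
    = (\<Sum>i<n. \<Sum>j<m. \<Sum>g\<in>carrier G. \<rho> (inv g) $$ (i, i) * \<sigma> g $$ (j, j))"
  proof (intro sum.cong refl)
    fix i j assume "i \<in> {..<n}" "j \<in> {..<m}"
    then have ij: "i < n" "j < m" by auto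
    have "(\<rho> (inv g) * unit_mat n m i j * \<sigma> g) $$ (i, j) = \<rho> (inv g) $$ (i, i) * \<sigma> g $$ (j, j)"
      if g: "g \<in> carrier G" for g
      using g ij by (intro mult_unit_mat_mult_index[OF r(1) s(1)]) auto
    then show "average n m \<rho> \<sigma> (unit_mat n m i j) $$ (i, j)
        = (\<Sum>g\<in>carrier G. \<rho> (inv g) $$ (i, i) * \<sigma> g $$ (j, j))"
      using ij by (simp add: average_def msum_def)
  qed
  also have "\<dots> = (\<Sum>g\<in>carrier G. \<Sum>i<n. \<Sum>j<m. \<rho> (inv g) $$ (i, i) * \<sigma> g $$ (j, j))"
    by (simp only: sum.swap[of _ "carrier G"])
  also have "\<dots> = (\<Sum>g\<in>carrier G. mat_trace (\<rho> (inv g)) * mat_trace (\<sigma> g))"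
  proof (intro sum.cong refl)
    fix g assume g: "g \<in> carrier G"
    then have "\<rho> (inv g) \<in> carrier_mat n n" "\<sigma> g \<in> carrier_mat m m" by (auto intro: r s)
    then show "(\<Sum>i<n. \<Sum>j<m. \<rho> (inv g) $$ (i, i) * \<sigma> g $$ (j, j)) = mat_trace (\<rho> (inv g)) * mat_trace (\<sigma> g)"
      by (simp add: mat_trace_def sum_product)
  qed
  finally show ?thesis by simp
qed

lemma row_orthogonality:
  assumes "\<chi> \<in> Irr G" "\<psi> \<in> Irr G"
  shows "(\<Sum>g\<in>carrier G. \<chi> g * cnj (\<psi> g)) = (if \<chi> = \<psi> then of_nat (card (carrier G)) else 0)"
proof -
  obtain n \<rho> where \<rho>: "irreducible_rep G n \<rho>" "complex_rep G n \<rho>" "n > 0"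
    "\<And>g. g \<in> carrier G \<Longrightarrow> \<psi> g = mat_trace (\<rho> g)" "\<psi> = rep_character G \<rho>"
    using IrrE[OF assms(2)] by metis
  obtain m \<sigma> where \<sigma>: "irreducible_rep G m \<sigma>" "complex_rep G m \<sigma>" "m > 0"
    "\<And>g. g \<in> carrier G \<Longrightarrow> \<chi> g = mat_trace (\<sigma> g)" "\<chi> = rep_character G \<sigma>"
    using IrrE[OF assms(1)] by metis
  show ?thesis
  proof (cases "\<chi> = \<psi>")
    case False
    have "(\<Sum>g\<in>carrier G. \<chi> g * cnj (\<psi> g)) = (\<Sum>g\<in>carrier G. mat_trace (\<rho> (inv g)) * mat_trace (\<sigma> g))"
      by (intro sum.cong) (auto simp: \<rho>(4) \<sigma>(4) mat_trace_rep_inv[OF \<rho>(2)])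
    also have "\<dots> = 0"
      using False unfolding sum_character_product[OF \<rho>(2) \<sigma>(2)]
      by (intro sum.neutral ballI) (auto simp: average_distinct[OF \<rho>(1) \<sigma>(1)] \<rho>(5) \<sigma>(5))
    finally show ?thesis using False by simp
  next
    \<comment> \<open>Equal characters may have been obtained from different representations
      \<open>\<rho>\<close> and \<open>\<sigma>\<close>; here both factors are computed with
      \<open>\<rho>\<close>. Only the terms \<open>i = j\<close> survive, each contributing the
      group order divided by \<open>n\<close>.\<close>
    case True
    have "(\<Sum>g\<in>carrier G. \<chi> g * cnj (\<psi> g)) = (\<Sum>g\<in>carrier G. mat_trace (\<rho> (inv g)) * mat_trace (\<rho> g))"
      by (intro sum.cong) (auto simp: \<rho>(4) True mat_trace_rep_inv[OF \<rho>(2)])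
    also have "\<dots> = (\<Sum>i<n. \<Sum>j<n. if j = i then of_nat (card (carrier G)) / of_nat n else 0)"
      unfolding sum_character_product[OF \<rho>(2) \<rho>(2)]
      by (intro sum.cong) (auto simp: average_irreducible[OF \<rho>(1)] mat_trace_unit_mat)
    also have "\<dots> = of_nat (card (carrier G))" using \<rho>(3) by simp
    finally show ?thesis using True by simp
  qed
qed

section \<open>Class functions acting on irreducible representations\<close>

definition class_function :: "('a \<Rightarrow> complex) \<Rightarrow> bool" where
  "class_function f \<longleftrightarrow> (\<forall>g\<in>carrier G. \<forall>x\<in>carrier G. f (g \<otimes> x \<otimes> inv g) = f x)"

text \<open>The matrix \<open>A\<close>, the sum of \<open>f h \<cdot>\<^sub>m \<rho> h\<close>,
  commutes with the representation, hence is a scalar \<open>c\<close>. The traces of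
  \<open>\<rho> g * A\<close> and of \<open>A\<close> are \<open>c * \<chi> g\<close> and
  \<open>c * \<chi> \<one>\<close>; eliminating \<open>c\<close> gives the equation.\<close>

lemma sum_class_function_mult:
  assumes f: "class_function f" and \<chi>: "\<chi> \<in> Irr G" and g: "g \<in> carrier G"
  shows "\<chi> \<one> * (\<Sum>h\<in>carrier G. f h * \<chi> (g \<otimes> h)) = \<chi> g * (\<Sum>h\<in>carrier G. f h * \<chi> h)"
proof -
  obtain n \<rho> where \<rho>: "irreducible_rep G n \<rho>" "complex_rep G n \<rho>" "n > 0"
    "\<And>g. g \<in> carrier G \<Longrightarrow> \<chi> g = mat_trace (\<rho> g)" "\<chi> \<one> = of_nat n"
    using IrrE[OF \<chi>] by metis
  note r = complex_repD[OF \<rho>(2)]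
  define A where "A = msum n n (carrier G) (\<lambda>h. f h \<cdot>\<^sub>m \<rho> h)"
  have A: "A \<in> carrier_mat n n" by (simp add: A_def)
  have left: "\<rho> k * A = msum n n (carrier G) (\<lambda>h. f h \<cdot>\<^sub>m \<rho> (k \<otimes> h))" if k: "k \<in> carrier G" for k
  proof -
    have "\<rho> k * A = msum n n (carrier G) (\<lambda>h. \<rho> k * (f h \<cdot>\<^sub>m \<rho> h))"
      unfolding A_def by (rule mult_msum) (use r k in auto)
    also have "\<dots> = msum n n (carrier G) (\<lambda>h. f h \<cdot>\<^sub>m \<rho> (k \<otimes> h))"
      by (rule msum_cong) (simp add: r(2) k mult_smult_distrib[OF r(1) r(1)])
    finally show ?thesis .
  qed
  have "A * \<rho> k = \<rho> k * A" if k: "k \<in> carrier G" for k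
  proof -
    have "A * \<rho> k = msum n n (carrier G) (\<lambda>h. (f h \<cdot>\<^sub>m \<rho> h) * \<rho> k)"
      unfolding A_def by (rule msum_mult) (use r k in auto)
    also have "\<dots> = msum n n (carrier G) (\<lambda>h. f h \<cdot>\<^sub>m \<rho> (h \<otimes> k))"
      by (rule msum_cong) (simp add: r(2) k mult_smult_assoc_mat[OF r(1) r(1)])
    \<comment> \<open>Conjugating the summation variable by \<open>k\<close> fixes the weights and
      turns \<open>h \<otimes> k\<close> into \<open>k \<otimes> h\<close>.\<close>
    also have "\<dots> = msum n n (carrier G) (\<lambda>h. f (k \<otimes> h \<otimes> inv k) \<cdot>\<^sub>m \<rho> (k \<otimes> h \<otimes> inv k \<otimes> k))"
      by (rule msum_reindex[OF bij_conj[OF k]])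
    also have "\<dots> = msum n n (carrier G) (\<lambda>h. f h \<cdot>\<^sub>m \<rho> (k \<otimes> h))"
      by (rule msum_cong) (use f k in \<open>simp add: class_function_def m_assoc\<close>)
    finally show ?thesis using left[OF k] by simp
  qed
  then obtain c where c: "A = c \<cdot>\<^sub>m 1\<^sub>m n" using schur[OF \<rho>(1) A] by metis
  have "\<rho> k * A = c \<cdot>\<^sub>m \<rho> k" if "k \<in> carrier G" for k
    unfolding c using r(1)[OF that] by (simp add: mult_smult_distrib[of _ n n _ n])
  then have "mat_trace (msum n n (carrier G) (\<lambda>h. f h \<cdot>\<^sub>m \<rho> (k \<otimes> h))) = c * \<chi> k" if "k \<in> carrier G" for k
    using left[OF that] \<rho>(4) that mat_trace_smult[OF r(1)[OF that], of c] by simp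
  moreover have "mat_trace (msum n n (carrier G) (\<lambda>h. f h \<cdot>\<^sub>m \<rho> (k \<otimes> h)))
      = (\<Sum>h\<in>carrier G. f h * \<chi> (k \<otimes> h))" if k: "k \<in> carrier G" for k
  proof -
    have "mat_trace (msum n n (carrier G) (\<lambda>h. f h \<cdot>\<^sub>m \<rho> (k \<otimes> h)))
        = (\<Sum>h\<in>carrier G. mat_trace (f h \<cdot>\<^sub>m \<rho> (k \<otimes> h)))"
      by (rule mat_trace_msum) (use r(1) k in auto)
    also have "\<dots> = (\<Sum>h\<in>carrier G. f h * \<chi> (k \<otimes> h))"
      by (intro sum.cong refl) (simp add: mat_trace_smult[OF r(1)] k \<rho>(4))
    finally show ?thesis .
  qed
  ultimately have eq: "(\<Sum>h\<in>carrier G. f h * \<chi> (k \<otimes> h)) = c * \<chi> k" if "k \<in> carrier G" for k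
    using that by simp
  have "(\<Sum>h\<in>carrier G. f h * \<chi> h) = (\<Sum>h\<in>carrier G. f h * \<chi> (\<one> \<otimes> h))"
    by (intro sum.cong) auto
  also have "\<dots> = c * \<chi> \<one>" by (rule eq) simp
  finally show ?thesis using eq[OF g] by (simp add: algebra_simps)
qed

section \<open>Completeness of the irreducible characters\<close>

text \<open>The hypothesis removes from each matrix product the terms that leave \<open>J\<close>,
  so cutting down to rows and columns in \<open>J\<close> is multiplicative. It covers both diagonal
  blocks of a block triangular representation, the subrepresentation and the quotient.\<close>

lemma block_rep:
  assumes rep: "complex_rep G n \<rho>" and J: "J \<subseteq> {..<n}"
    and block: "\<And>g h i j l. g \<in> carrier G \<Longrightarrow> h \<in> carrier G \<Longrightarrow> i \<in> J \<Longrightarrow> j \<in> J \<Longrightarrow> l < n \<Longrightarrow> l \<notin> J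
      \<Longrightarrow> \<rho> g $$ (i, l) * \<rho> h $$ (l, j) = 0"
  obtains \<tau> where "complex_rep G (card J) \<tau>" "\<And>g. mat_trace (\<tau> g) = (\<Sum>i\<in>J. \<rho> g $$ (i, i))"
proof -
  note r = complex_repD[OF rep]
  have "finite J" using J finite_subset by blast
  then obtain e where e: "bij_betw e {..<card J} J"
    using ex_bij_betw_nat_finite[of J] by (auto simp: atLeast0LessThan)
  have eJ: "e i \<in> J" "e i < n" if "i < card J" for i
    using that e J by (auto simp: bij_betw_def)
  define \<tau> where "\<tau> g = mat (card J) (card J) (\<lambda>(i, j). \<rho> g $$ (e i, e j))" for g
  have "complex_rep G (card J) \<tau>"
    unfolding complex_rep_iff
  proof (intro conjI ballI)
    show "\<tau> g \<in> carrier_mat (card J) (card J)" for g by (simp add: \<tau>_def)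
    show "\<tau> \<one> = 1\<^sub>m (card J)"
    proof (rule eq_matI)
      fix i j assume "i < dim_row (1\<^sub>m (card J))" "j < dim_col (1\<^sub>m (card J))"
      then have ij: "i < card J" "j < card J" by auto
      then have "e i = e j \<longleftrightarrow> i = j"
        using e by (auto simp: bij_betw_def inj_on_def)
      then show "\<tau> \<one> $$ (i, j) = 1\<^sub>m (card J) $$ (i, j)"
        using ij eJ by (simp add: \<tau>_def r(3))
    qed (auto simp: \<tau>_def)
    fix g h assume gh: "g \<in> carrier G" "h \<in> carrier G"
    show "\<tau> (g \<otimes> h) = \<tau> g * \<tau> h"
    proof (rule eq_matI)
      fix i j assume "i < dim_row (\<tau> g * \<tau> h)" "j < dim_col (\<tau> g * \<tau> h)"
      then have ij: "i < card J" "j < card J" by (auto simp: \<tau>_def)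
      have "\<tau> (g \<otimes> h) $$ (i, j) = (\<rho> g * \<rho> h) $$ (e i, e j)"
        using ij gh by (simp add: \<tau>_def r(2))
      also have "\<dots> = (\<Sum>l<n. \<rho> g $$ (e i, l) * \<rho> h $$ (l, e j))"
        using ij eJ by (intro mult_mat_index[OF r(1)[OF gh(1)] r(1)[OF gh(2)]])
      also have "\<dots> = (\<Sum>l\<in>J. \<rho> g $$ (e i, l) * \<rho> h $$ (l, e j))"
        using J block gh ij eJ by (intro sum.mono_neutral_right) auto
      also have "\<dots> = (\<Sum>l<card J. \<rho> g $$ (e i, e l) * \<rho> h $$ (e l, e j))"
        by (rule sum.reindex_bij_betw[OF e, symmetric])
      also have "\<dots> = (\<Sum>l<card J. \<tau> g $$ (i, l) * \<tau> h $$ (l, j))"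
        using ij by (intro sum.cong) (auto simp: \<tau>_def)
      also have "\<dots> = (\<tau> g * \<tau> h) $$ (i, j)"
        using ij by (intro mult_mat_index[symmetric, of _ "card J" "card J" _ "card J"]) (auto simp: \<tau>_def)
      finally show "\<tau> (g \<otimes> h) $$ (i, j) = (\<tau> g * \<tau> h) $$ (i, j)" .
    qed (auto simp: \<tau>_def)
  qed
  moreover have "mat_trace (\<tau> g) = (\<Sum>i\<in>J. \<rho> g $$ (i, i))" for g
    using sum.reindex_bij_betw[OF e, of "\<lambda>i. \<rho> g $$ (i, i)"] by (simp add: mat_trace_def \<tau>_def)
  ultimately show thesis by (rule that)
qed

lemma conjugate_rep:
  assumes rep: "complex_rep G n \<rho>" and P: "P \<in> carrier_mat n n" and Q: "Q \<in> carrier_mat n n"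
    and PQ: "P * Q = 1\<^sub>m n" and QP: "Q * P = 1\<^sub>m n"
  shows "complex_rep G n (\<lambda>g. Q * \<rho> g * P)"
  unfolding complex_rep_iff
proof (intro conjI ballI)
  note r = complex_repD[OF rep]
  show "Q * \<rho> g * P \<in> carrier_mat n n" if "g \<in> carrier G" for g
    using r(1)[OF that] P Q by simp
  show "Q * \<rho> \<one> * P = 1\<^sub>m n" using r(3) P Q QP by simp
  fix g h assume g: "g \<in> carrier G" and h: "h \<in> carrier G"
  have "Q * \<rho> g * P * (Q * \<rho> h * P) = Q * \<rho> g * P * (Q * \<rho> h) * P"
    using r(1)[OF g] r(1)[OF h] P Q by (intro assoc_mult_mat[symmetric, of _ n n _ n _ n]) auto
  also have "Q * \<rho> g * P * (Q * \<rho> h) = Q * \<rho> g * P * Q * \<rho> h"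
    using r(1)[OF g] r(1)[OF h] P Q by (intro assoc_mult_mat[symmetric, of _ n n _ n _ n]) auto
  also have "Q * \<rho> g * P * Q = Q * \<rho> g * (P * Q)"
    using r(1)[OF g] P Q by (intro assoc_mult_mat[of _ n n _ n _ n]) auto
  also have "\<dots> = Q * \<rho> g" using r(1)[OF g] Q PQ by simp
  also have "Q * \<rho> g * \<rho> h = Q * (\<rho> g * \<rho> h)"
    by (rule assoc_mult_mat[OF Q r(1)[OF g] r(1)[OF h]])
  finally show "Q * \<rho> (g \<otimes> h) * P = Q * \<rho> g * P * (Q * \<rho> h * P)" by (simp add: r(2)[OF g h])
qed

lemma reducible_rep_splits:
  assumes rep: "complex_rep G n \<rho>" and n: "n > 0" and red: "\<not> irreducible_rep G n \<rho>"
  obtains k l \<sigma> \<tau> where "k < n" "l < n" "complex_rep G k \<sigma>" "complex_rep G l \<tau>"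
    "\<And>g. g \<in> carrier G \<Longrightarrow> mat_trace (\<rho> g) = mat_trace (\<sigma> g) + mat_trace (\<tau> g)"
proof -
  note r = complex_repD[OF rep]
  from red rep n obtain W where sub: "VectorSpace.subspace class_ring W (module_vec TYPE(complex) n)"
    and inv: "\<And>g w. g \<in> carrier G \<Longrightarrow> w \<in> W \<Longrightarrow> \<rho> g *\<^sub>v w \<in> W"
    and proper: "W \<noteq> {0\<^sub>v n}" "W \<noteq> carrier_vec n"
    by (auto simp: irreducible_rep_def)
  have W: "W \<subseteq> carrier_vec n" "0\<^sub>v n \<in> W" "\<And>v w. v \<in> W \<Longrightarrow> w \<in> W \<Longrightarrow> v + w \<in> W" "\<And>c v. v \<in> W \<Longrightarrow> c \<cdot>\<^sub>v v \<in> W"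
    using sub by (simp_all add: subspace_iff)
  obtain J P Q where J: "J \<subseteq> {..<n}" and P: "P \<in> carrier_mat n n" and Q: "Q \<in> carrier_mat n n"
    and PQ: "P * Q = 1\<^sub>m n" and QP: "Q * P = 1\<^sub>m n" and cols: "\<And>j. j \<in> J \<Longrightarrow> col P j \<in> W"
    and coords: "\<And>w i. w \<in> W \<Longrightarrow> i < n \<Longrightarrow> i \<notin> J \<Longrightarrow> (Q *\<^sub>v w) $ i = 0"
    using adapted_basis[OF W(1)] by metis
  have PQv: "P *\<^sub>v (Q *\<^sub>v v) = v" if "v \<in> carrier_vec n" for v
    using assoc_mult_mat_vec[OF P Q that] PQ that by simp
  \<comment> \<open>Both blocks have to be smaller than \<open>n\<close>: if all columns of
    \<open>P\<close> lay in \<open>W\<close>, then \<open>W\<close> would be the full space, and if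
    \<open>J\<close> were empty, all coordinates of vectors in \<open>W\<close> would
    vanish.\<close>
  have "J \<noteq> {..<n}"
  proof
    assume "J = {..<n}"
    then have "v \<in> W" if v: "v \<in> carrier_vec n" for v
      using mult_mat_vec_in_subspace[OF W P, of "Q *\<^sub>v v"] cols PQv[OF v] v Q by simp
    then have "W = carrier_vec n" using W(1) by auto
    then show False using proper(2) by simp
  qed
  moreover have "J \<noteq> {}"
  proof
    assume "J = {}"
    have "w = 0\<^sub>v n" if w: "w \<in> W" for w
    proof -
      have "Q *\<^sub>v w = 0\<^sub>v n" using coords[OF w] \<open>J = {}\<close> Q by (intro eq_vecI) auto
      moreover have "P *\<^sub>v 0\<^sub>v n = 0\<^sub>v n" using P by (intro eq_vecI) auto
      ultimately show ?thesis using PQv[OF subsetD[OF W(1) w]] by (metis (no_types))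
    qed
    then have "W = {0\<^sub>v n}" using W(2) by (intro Set.set_eqI) (metis singleton_iff)
    then show False using proper(1) by simp
  qed
  moreover have fin: "finite J" using J finite_subset by blast
  ultimately have "J \<subset> {..<n}" "card J > 0" using J by (simp_all add: psubset_eq card_gt_0_iff)
  then have card: "card J < n" "card ({..<n} - J) < n"
    using psubset_card_mono[of "{..<n}" J] fin n by (simp_all add: card_Diff_subset[OF fin J])
  define \<sigma> where "\<sigma> g = Q * \<rho> g * P" for g
  have \<sigma>: "complex_rep G n \<sigma>"
    unfolding \<sigma>_def by (rule conjugate_rep[OF rep P Q PQ QP])
  \<comment> \<open>Column \<open>j\<close> of \<open>P\<close> lies in \<open>W\<close>, so does
    its image under \<open>\<rho> g\<close>, and vectors of \<open>W\<close> have no coordinates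
    outside \<open>J\<close>.\<close>
  have zero: "\<sigma> g $$ (i, j) = 0" if g: "g \<in> carrier G" and i: "i < n" "i \<notin> J" and j: "j \<in> J" for g i j
  proof -
    have jn: "j < n" using j J by auto
    have Pj: "col P j \<in> carrier_vec n" using P by auto
    have "\<sigma> g $$ (i, j) = col (Q * \<rho> g * P) j $ i"
      using i jn P Q by (simp add: \<sigma>_def)
    also have "col (Q * \<rho> g * P) j = (Q * \<rho> g) *\<^sub>v col P j"
      using r(1)[OF g] P Q jn by (intro col_mult2[of _ n n]) auto
    also have "\<dots> = Q *\<^sub>v (\<rho> g *\<^sub>v col P j)"
      using r(1)[OF g] Q Pj by (intro assoc_mult_mat_vec[of _ n n _ n]) auto
    finally show ?thesis using coords[OF inv[OF g cols[OF j]] i] by simp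
  qed
  \<comment> \<open>On \<open>J\<close> it is the second factor of each unwanted product that
    vanishes; on the complement below it is the first.\<close>
  obtain \<tau>1 where 1: "complex_rep G (card J) \<tau>1" "\<And>g. mat_trace (\<tau>1 g) = (\<Sum>i\<in>J. \<sigma> g $$ (i, i))"
  proof (rule block_rep[OF \<sigma> J])
    show "\<sigma> g $$ (i, l) * \<sigma> h $$ (l, j) = 0"
      if "g \<in> carrier G" "h \<in> carrier G" "i \<in> J" "j \<in> J" "l < n" "l \<notin> J" for g h i j l
      using zero[of h l j] that by simp
  qed (rule that)
  obtain \<tau>2 where 2: "complex_rep G (card ({..<n} - J)) \<tau>2"
    "\<And>g. mat_trace (\<tau>2 g) = (\<Sum>i\<in>{..<n} - J. \<sigma> g $$ (i, i))"
  proof (rule block_rep[OF \<sigma>, of "{..<n} - J"])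
    show "\<sigma> g $$ (i, l) * \<sigma> h $$ (l, j) = 0"
      if "g \<in> carrier G" "h \<in> carrier G" "i \<in> {..<n} - J" "j \<in> {..<n} - J" "l < n" "l \<notin> {..<n} - J"
      for g h i j l
      using that zero[of g i l] by simp
  qed auto
  show thesis
  proof (rule that[OF card 1(1) 2(1)])
    fix g assume g: "g \<in> carrier G"
    have "mat_trace (\<rho> g) = mat_trace (\<sigma> g)"
      using mat_trace_similar[OF r(1)[OF g] P Q PQ] by (simp add: \<sigma>_def)
    also have "\<dots> = (\<Sum>i<n. \<sigma> g $$ (i, i))"
      using complex_repD(1)[OF \<sigma> g] by (simp add: mat_trace_def)
    also have "\<dots> = (\<Sum>i\<in>{..<n} - J. \<sigma> g $$ (i, i)) + (\<Sum>i\<in>J. \<sigma> g $$ (i, i))"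
      by (rule sum.subset_diff[OF J]) simp
    finally show "mat_trace (\<rho> g) = mat_trace (\<tau>1 g) + mat_trace (\<tau>2 g)" by (simp add: 1 2)
  qed
qed

lemma sum_mat_trace_eq_0:
  assumes orth: "\<And>\<chi>. \<chi> \<in> Irr G \<Longrightarrow> (\<Sum>g\<in>carrier G. f g * \<chi> g) = 0"
    and rep: "complex_rep G n \<rho>"
  shows "(\<Sum>g\<in>carrier G. f g * mat_trace (\<rho> g)) = 0"
  using rep
proof (induction n arbitrary: \<rho> rule: less_induct)
  case (less n)
  consider "n = 0" | "irreducible_rep G n \<rho>" | "n > 0" "\<not> irreducible_rep G n \<rho>" by auto
  then show ?case
  proof cases
    \<comment> \<open>Irreducible representations have positive dimension, so dimension 0 is a case
      of its own, with an empty trace.\<close>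
    case 1
    then have "mat_trace (\<rho> g) = 0" if "g \<in> carrier G" for g
      using complex_repD(1)[OF less.prems that] by (simp add: mat_trace_def)
    then show ?thesis by simp
  next
    case 2
    then have "rep_character G \<rho> \<in> Irr G" by (auto simp: Irr_def)
    from orth[OF this] show ?thesis by (simp add: rep_character_def)
  next
    case 3
    obtain k l \<sigma> \<tau> where "k < n" "l < n" "complex_rep G k \<sigma>" "complex_rep G l \<tau>"
      "\<And>g. g \<in> carrier G \<Longrightarrow> mat_trace (\<rho> g) = mat_trace (\<sigma> g) + mat_trace (\<tau> g)"
      using reducible_rep_splits[OF less.prems 3] by metis
    then show ?thesis
      using less.IH[of k \<sigma>] less.IH[of l \<tau>] by (simp add: distrib_left sum.distrib)
  qed
qed

text \<open>Permutation matrices of left translation, along an enumeration \<open>e\<close> of the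
  group. Translation by \<open>g \<noteq> \<one>\<close> has no fixed point, hence a zero
  diagonal.\<close>

lemma regular_rep:
  obtains \<rho> where "complex_rep G (card (carrier G)) \<rho>"
    "\<And>g. g \<in> carrier G \<Longrightarrow> mat_trace (\<rho> g) = (if g = \<one> then of_nat (card (carrier G)) else 0)"
proof -
  let ?N = "card (carrier G)"
  obtain e where e: "bij_betw e {..<?N} (carrier G)"
    using ex_bij_betw_nat_finite[OF finite_carrier] by (auto simp: atLeast0LessThan)
  have eG: "e i \<in> carrier G" if "i < ?N" for i using that e by (auto simp: bij_betw_def)
  have e_inj: "e i = e j \<longleftrightarrow> i = j" if "i < ?N" "j < ?N" for i j
    using that e by (auto simp: bij_betw_def inj_on_def)
  define \<rho> where "\<rho> g = mat ?N ?N (\<lambda>(i, j). if e i = g \<otimes> e j then 1 else (0 :: complex))" for g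
  have car: "\<rho> g \<in> carrier_mat ?N ?N" for g by (simp add: \<rho>_def)
  have "complex_rep G ?N \<rho>"
    unfolding complex_rep_iff
  proof (intro conjI ballI car)
    show "\<rho> \<one> = 1\<^sub>m ?N"
      by (rule eq_matI) (auto simp: \<rho>_def eG e_inj)
    fix g h assume g: "g \<in> carrier G" and h: "h \<in> carrier G"
    show "\<rho> (g \<otimes> h) = \<rho> g * \<rho> h"
    proof (rule eq_matI)
      fix i j assume "i < dim_row (\<rho> g * \<rho> h)" "j < dim_col (\<rho> g * \<rho> h)"
      then have ij: "i < ?N" "j < ?N" by (auto simp: \<rho>_def)
      have "(\<rho> g * \<rho> h) $$ (i, j) = (\<Sum>l<?N. \<rho> g $$ (i, l) * \<rho> h $$ (l, j))"
        by (rule mult_mat_index[OF car car ij])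
      also have "\<dots> = (\<Sum>l<?N. if e l = h \<otimes> e j then (if e i = g \<otimes> e l then 1 else 0) else 0)"
        using ij by (intro sum.cong) (auto simp: \<rho>_def)
      \<comment> \<open>Back in the group, the only surviving index is
        \<open>y = h \<otimes> e j\<close>, with no need to name its position in the
        enumeration.\<close>
      also have "\<dots> = (\<Sum>y\<in>carrier G. if y = h \<otimes> e j then (if e i = g \<otimes> y then 1 else 0) else 0)"
        by (rule sum.reindex_bij_betw[OF e])
      also have "\<dots> = (if e i = g \<otimes> (h \<otimes> e j) then 1 else 0)"
        using finite_carrier h eG ij by (simp add: sum.delta)
      finally show "\<rho> (g \<otimes> h) $$ (i, j) = (\<rho> g * \<rho> h) $$ (i, j)"
        using ij g h eG by (simp add: \<rho>_def m_assoc)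
    qed (auto simp: \<rho>_def)
  qed
  moreover have "mat_trace (\<rho> g) = (if g = \<one> then of_nat ?N else 0)" if g: "g \<in> carrier G" for g
  proof -
    have "mat_trace (\<rho> g) = (\<Sum>i<?N. if g = \<one> then 1 else 0)"
      unfolding mat_trace_def using car[of g]
      by (intro sum.cong) (use g eG in \<open>auto simp: \<rho>_def\<close>)
    then show ?thesis by simp
  qed
  ultimately show thesis by (rule that)
qed

section \<open>Vanishing criterion, finiteness of \<open>Irr G\<close> and expansion of class
  functions\<close>

lemma Irr_one_neq_0: "\<chi> \<in> Irr G \<Longrightarrow> \<chi> \<one> \<noteq> 0"
  by (elim IrrE) simp

lemma class_function_Irr:
  assumes "\<chi> \<in> Irr G"
  shows "class_function \<chi>"
  unfolding class_function_def
proof (intro ballI)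
  fix g x assume g: "g \<in> carrier G" and x: "x \<in> carrier G"
  obtain n \<rho> where \<rho>: "complex_rep G n \<rho>" "\<And>g. g \<in> carrier G \<Longrightarrow> \<chi> g = mat_trace (\<rho> g)"
    using IrrE[OF assms] by metis
  note r = complex_repD[OF \<rho>(1)]
  have "\<rho> (inv g) * \<rho> g = 1\<^sub>m n" using g by (simp add: r(2)[symmetric] r(3))
  then show "\<chi> (g \<otimes> x \<otimes> inv g) = \<chi> x"
    using mat_trace_similar[OF r(1)[OF x] r(1) r(1)[OF g], of "inv g"] g x by (simp add: \<rho>(2) r(2))
qed

lemma class_function_eq_0:
  assumes f: "class_function f"
    and orth: "\<And>\<chi>. \<chi> \<in> Irr G \<Longrightarrow> (\<Sum>g\<in>carrier G. f g * \<chi> g) = 0"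
    and g: "g \<in> carrier G"
  shows "f g = 0"
proof -
  \<comment> \<open>Moving the translation onto the character gives
    \<open>\<chi> (inv g \<otimes> h)\<close>, whose weighted sum is a multiple of the one for
    \<open>\<chi> h\<close>.\<close>
  have "(\<Sum>h\<in>carrier G. f (g \<otimes> h) * \<chi> h) = 0" if \<chi>: "\<chi> \<in> Irr G" for \<chi>
  proof -
    have "(\<Sum>h\<in>carrier G. f h * \<chi> (inv g \<otimes> h)) = 0"
      using sum_class_function_mult[OF f \<chi>, of "inv g"] orth[OF \<chi>] Irr_one_neq_0[OF \<chi>] g by simp
    moreover have "(\<Sum>h\<in>carrier G. f h * \<chi> (inv g \<otimes> h)) = (\<Sum>h\<in>carrier G. f (g \<otimes> h) * \<chi> (inv g \<otimes> (g \<otimes> h)))"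
      by (rule sum.reindex_bij_betw[OF bij_mult_left[OF g], symmetric])
    ultimately show ?thesis using g by (simp add: mult_inv_cancel)
  qed
  moreover obtain \<rho> where \<rho>: "complex_rep G (card (carrier G)) \<rho>"
    "\<And>g. g \<in> carrier G \<Longrightarrow> mat_trace (\<rho> g) = (if g = \<one> then of_nat (card (carrier G)) else 0)"
    using regular_rep by metis
  ultimately have "(\<Sum>h\<in>carrier G. f (g \<otimes> h) * mat_trace (\<rho> h)) = 0"
    by (intro sum_mat_trace_eq_0[OF _ \<rho>(1)])
  moreover have "(\<Sum>h\<in>carrier G. f (g \<otimes> h) * mat_trace (\<rho> h))
      = (\<Sum>h\<in>carrier G. if h = \<one> then f (g \<otimes> h) * of_nat (card (carrier G)) else 0)"
    by (intro sum.cong) (auto simp: \<rho>(2))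
  ultimately show ?thesis
    using finite_carrier g card_carrier_pos by auto
qed

text \<open>Row orthogonality recovers the coefficients. Stated for finite subsets, it serves both
  the proof that \<open>Irr G\<close> is finite and the expansion over all of
  \<open>Irr G\<close>.\<close>

lemma sum_expansion_mult_cnj:
  assumes "finite S" "S \<subseteq> Irr G" "\<psi> \<in> S"
  shows "(\<Sum>g\<in>carrier G. (\<Sum>\<chi>\<in>S. a \<chi> / of_nat (card (carrier G)) * \<chi> g) * cnj (\<psi> g)) = a \<psi>"
proof -
  let ?N = "of_nat (card (carrier G)) :: complex"
  have "(\<Sum>g\<in>carrier G. (\<Sum>\<chi>\<in>S. a \<chi> / ?N * \<chi> g) * cnj (\<psi> g))
      = (\<Sum>\<chi>\<in>S. \<Sum>g\<in>carrier G. a \<chi> / ?N * (\<chi> g * cnj (\<psi> g)))"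
    by (subst sum.swap) (simp add: sum_distrib_right mult.assoc)
  also have "\<dots> = (\<Sum>\<chi>\<in>S. if \<chi> = \<psi> then a \<chi> else 0)"
    using assms card_carrier_pos
    by (intro sum.cong refl, subst sum_distrib_left[symmetric], subst row_orthogonality) auto
  finally show ?thesis using assms by simp
qed

text \<open>In Bessel's inequality for the indicator function of \<open>\<one>\<close>, each irreducible character
  contributes at least \<open>1 / |G|\<close>.\<close>

lemma finite_Irr: "finite (Irr G)"
proof (rule ccontr)
  let ?N = "of_nat (card (carrier G)) :: complex"
  assume "infinite (Irr G)"
  then obtain S where S: "finite S" "card S = Suc (card (carrier G))" "S \<subseteq> Irr G"
    using infinite_arbitrarily_large by blast
  \<comment> \<open>The orthogonal projection of the indicator function of \<open>\<one>\<close> to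
    the span of \<open>S\<close>; \<open>h\<close> is the remainder.\<close>
  define p where "p g = (\<Sum>\<chi>\<in>S. \<chi> \<one> / ?N * \<chi> g)" for g
  define h where "h g = (if g = \<one> then 1 else 0) - p g" for g
  have cnj_one: "cnj (\<chi> \<one>) = \<chi> \<one>" if "\<chi> \<in> S" for \<chi>
  proof -
    have "\<chi> \<in> Irr G" using that S by auto
    then show ?thesis by (elim IrrE) simp
  qed
  have orth: "(\<Sum>g\<in>carrier G. h g * cnj (\<psi> g)) = 0" if \<psi>: "\<psi> \<in> S" for \<psi>
  proof -
    have "(\<Sum>g\<in>carrier G. h g * cnj (\<psi> g))
        = (\<Sum>g\<in>carrier G. if g = \<one> then cnj (\<psi> g) else 0) - (\<Sum>g\<in>carrier G. p g * cnj (\<psi> g))"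
      by (subst sum_subtractf[symmetric], intro sum.cong) (auto simp: h_def algebra_simps)
    also have "\<dots> = \<psi> \<one> - \<psi> \<one>"
      using sum_expansion_mult_cnj[OF S(1,3) \<psi>, of "\<lambda>\<chi>. \<chi> \<one>"] finite_carrier cnj_one[OF \<psi>]
      by (simp add: p_def)
    finally show ?thesis by simp
  qed
  have "(\<Sum>g\<in>carrier G. h g * cnj (p g)) = (\<Sum>\<chi>\<in>S. \<chi> \<one> / ?N * (\<Sum>g\<in>carrier G. h g * cnj (\<chi> g)))"
    unfolding sum_distrib_left
    by (subst sum.swap) (auto simp: p_def sum_distrib_left cnj_one algebra_simps intro!: sum.cong)
  also have "\<dots> = 0" by (simp add: orth)
  finally have hp: "(\<Sum>g\<in>carrier G. h g * cnj (p g)) = 0" .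
  \<comment> \<open>As \<open>h\<close> is orthogonal to \<open>p\<close>, its squared norm is its
    product with the indicator function, namely \<open>h \<one>\<close>. Nonnegativity then bounds
    the sum of the squared degrees by the group order, while \<open>S\<close> has one character too
    many for that.\<close>
  have "(\<Sum>g\<in>carrier G. h g * cnj (h g))
      = (\<Sum>g\<in>carrier G. if g = \<one> then h g else 0) - (\<Sum>g\<in>carrier G. h g * cnj (p g))"
    by (subst sum_subtractf[symmetric], intro sum.cong) (auto simp: h_def algebra_simps)
  also have "\<dots> = h \<one>" unfolding hp using finite_carrier by simp
  also have "\<dots> = 1 - (\<Sum>\<chi>\<in>S. (\<chi> \<one>)\<^sup>2) / ?N"
    by (simp add: h_def p_def sum_divide_distrib power2_eq_square)
  finally have "(\<Sum>\<chi>\<in>S. (\<chi> \<one>)\<^sup>2) / ?N = 1 - (\<Sum>g\<in>carrier G. h g * cnj (h g))" by simp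
  also have "\<dots> = of_real (1 - (\<Sum>g\<in>carrier G. (cmod (h g))\<^sup>2))"
    by (simp only: of_real_diff of_real_1 of_real_sum complex_norm_square)
  finally have "Re ((\<Sum>\<chi>\<in>S. (\<chi> \<one>)\<^sup>2) / ?N) \<le> 1"
    by (simp add: sum_nonneg)
  moreover have "Re ((\<Sum>\<chi>\<in>S. (\<chi> \<one>)\<^sup>2) / ?N) = (\<Sum>\<chi>\<in>S. Re ((\<chi> \<one>)\<^sup>2)) / of_nat (card (carrier G))"
    by (simp add: Re_divide_of_nat)
  ultimately have "(\<Sum>\<chi>\<in>S. Re ((\<chi> \<one>)\<^sup>2)) \<le> of_nat (card (carrier G))"
    using card_carrier_pos by simp
  moreover have "(\<Sum>\<chi>\<in>S. Re ((\<chi> \<one>)\<^sup>2)) \<ge> (\<Sum>\<chi>\<in>S. 1)"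
  proof (rule sum_mono)
    fix \<chi> assume "\<chi> \<in> S"
    then have "\<chi> \<in> Irr G" using S by auto
    then obtain n where n: "n > 0" "\<chi> \<one> = of_nat n" by (elim IrrE)
    have "Re ((\<chi> \<one>)\<^sup>2) = (real n)\<^sup>2" unfolding n by (simp flip: of_nat_power)
    then show "1 \<le> Re ((\<chi> \<one>)\<^sup>2)" using n by simp
  qed
  ultimately show False using S by simp
qed

lemma class_function_expansion:
  assumes f: "class_function f" and g: "g \<in> carrier G"
  shows "f g = (\<Sum>\<chi>\<in>Irr G. (\<Sum>h\<in>carrier G. f h * cnj (\<chi> h)) / of_nat (card (carrier G)) * \<chi> g)"
proof -
  let ?N = "of_nat (card (carrier G)) :: complex"
  define a where "a \<chi> = (\<Sum>h\<in>carrier G. f h * cnj (\<chi> h))" for \<chi>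
  define e where "e k = f k - (\<Sum>\<chi>\<in>Irr G. a \<chi> / ?N * \<chi> k)" for k
  have e: "class_function e"
    using f class_function_Irr by (auto simp: class_function_def e_def intro!: sum.cong)
  \<comment> \<open>The remainder \<open>e\<close> is orthogonal to the characters with a conjugate,
    but \<open>class_function_eq_0\<close> tests without one. Replacing the argument by its inverse
    exchanges the two.\<close>
  have e_inv: "class_function (\<lambda>k. e (inv k))"
    using e by (auto simp: class_function_def inv_mult_group m_assoc)
  have "(\<Sum>k\<in>carrier G. e (inv k) * \<chi> k) = 0" if \<chi>: "\<chi> \<in> Irr G" for \<chi>
  proof -
    have "(\<Sum>k\<in>carrier G. e (inv k) * \<chi> k) = (\<Sum>k\<in>carrier G. e (inv k) * cnj (\<chi> (inv k)))"
      by (intro sum.cong) (auto simp: Irr_inv[OF \<chi>])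
    also have "\<dots> = (\<Sum>k\<in>carrier G. e k * cnj (\<chi> k))"
      by (rule sum.reindex_bij_betw[OF bij_inv])
    also have "\<dots> = a \<chi> - a \<chi>"
      using sum_expansion_mult_cnj[OF finite_Irr subset_refl \<chi>, of a]
      by (simp add: e_def left_diff_distrib sum_subtractf a_def)
    finally show ?thesis by simp
  qed
  from class_function_eq_0[OF e_inv this, of "inv g"] g have "e g = 0" by simp
  then show ?thesis by (simp add: e_def a_def)
qed

section \<open>Counting factorizations\<close>

lemma conj_class_eq: "x \<in> carrier G \<Longrightarrow> conj_class G x = (\<lambda>g. g \<otimes> x \<otimes> inv g) ` carrier G"
  by (auto simp: conj_class_def orbit_def)

lemma conj_class_subset: "x \<in> carrier G \<Longrightarrow> conj_class G x \<subseteq> carrier G"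
  by (auto simp: conj_class_eq)

lemma conj_class_closed:
  assumes x: "x \<in> carrier G" and y: "y \<in> conj_class G x" and k: "k \<in> carrier G"
  shows "k \<otimes> y \<otimes> inv k \<in> conj_class G x"
proof -
  obtain g where g: "g \<in> carrier G" "y = g \<otimes> x \<otimes> inv g" using x y by (auto simp: conj_class_eq)
  then have "k \<otimes> y \<otimes> inv k = (k \<otimes> g) \<otimes> x \<otimes> inv (k \<otimes> g)"
    using x k by (simp add: inv_mult_group m_assoc)
  then show ?thesis using g k x by (auto simp: conj_class_eq)
qed

lemma conj_class_closed_iff:
  assumes x: "x \<in> carrier G" and y: "y \<in> carrier G" and k: "k \<in> carrier G"
  shows "k \<otimes> y \<otimes> inv k \<in> conj_class G x \<longleftrightarrow> y \<in> conj_class G x"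
proof
  assume "k \<otimes> y \<otimes> inv k \<in> conj_class G x"
  from conj_class_closed[OF x this, of "inv k"] show "y \<in> conj_class G x"
    using k y by (simp add: m_assoc mult_inv_cancel)
qed (rule conj_class_closed[OF x _ k])

lemma bij_betw_conj_class:
  assumes x: "x \<in> carrier G" and k: "k \<in> carrier G"
  shows "bij_betw (\<lambda>y. k \<otimes> y \<otimes> inv k) (conj_class G x) (conj_class G x)"
proof (rule bij_betw_byWitness[of _ "\<lambda>y. inv k \<otimes> y \<otimes> k"])
  show "(\<lambda>y. k \<otimes> y \<otimes> inv k) ` conj_class G x \<subseteq> conj_class G x"
    using conj_class_closed[OF x _ k] by auto
  show "(\<lambda>y. inv k \<otimes> y \<otimes> k) ` conj_class G x \<subseteq> conj_class G x"
    using conj_class_closed[OF x, of _ "inv k"] k by auto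
qed (use conj_class_subset[OF x] k in \<open>auto simp: m_assoc mult_inv_cancel\<close>)

text \<open>The recursion splits off the last factor, in step with \<open>set_power\<close>, which
  multiplies by \<open>K\<close> on the right.\<close>

primrec num_fact :: "'a set \<Rightarrow> nat \<Rightarrow> 'a \<Rightarrow> nat" where
  "num_fact K 0 g = (if g = \<one> then 1 else 0)"
| "num_fact K (Suc n) g = (\<Sum>y\<in>K. num_fact K n (g \<otimes> inv y))"

lemma set_power_eq:
  assumes K: "K \<subseteq> carrier G"
  shows "set_power G K n = {g \<in> carrier G. num_fact K n g \<noteq> 0}"
proof (induction n)
  case 0
  then show ?case by auto
next
  case (Suc n)
  have fin: "finite K" using K finite_carrier finite_subset by blast
  show ?case
  proof (intro equalityI subsetI)
    fix g assume "g \<in> set_power G K (Suc n)"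
    then obtain h y where h: "h \<in> carrier G" "num_fact K n h \<noteq> 0" and y: "y \<in> K" and g: "g = h \<otimes> y"
      unfolding set_power.simps Suc set_mult_def by blast
    then have "g \<otimes> inv y = h" using K by (auto simp: m_assoc)
    then show "g \<in> {g \<in> carrier G. num_fact K (Suc n) g \<noteq> 0}"
      using h y g K fin by (auto intro!: bexI[of _ y])
  next
    fix g assume "g \<in> {g \<in> carrier G. num_fact K (Suc n) g \<noteq> 0}"
    then obtain y where g: "g \<in> carrier G" and y: "y \<in> K" "num_fact K n (g \<otimes> inv y) \<noteq> 0"
      using fin by auto
    then have "g = (g \<otimes> inv y) \<otimes> y" "g \<otimes> inv y \<in> carrier G" using K by (auto simp: m_assoc)
    then show "g \<in> set_power G K (Suc n)"
      unfolding set_power.simps Suc set_mult_def using y by blast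
  qed
qed

text \<open>Substitute \<open>g \<otimes> y\<close> for \<open>g\<close>, where \<open>y\<close> is
  the last factor. With \<open>F = 1\<close> this is the recursion for the total count, with
  \<open>F = \<chi>\<close> the one for the character sum, hence the general semiring.\<close>

lemma sum_num_fact_Suc:
  fixes F :: "'a \<Rightarrow> 'c::comm_semiring_1"
  assumes K: "K \<subseteq> carrier G"
  shows "(\<Sum>g\<in>carrier G. of_nat (num_fact K (Suc n) g) * F g)
    = (\<Sum>g\<in>carrier G. of_nat (num_fact K n g) * (\<Sum>y\<in>K. F (g \<otimes> y)))"
proof -
  have "(\<Sum>g\<in>carrier G. of_nat (num_fact K (Suc n) g) * F g)
      = (\<Sum>y\<in>K. \<Sum>g\<in>carrier G. of_nat (num_fact K n (g \<otimes> inv y)) * F g)"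
    by (subst sum.swap) (simp add: sum_distrib_right)
  also have "\<dots> = (\<Sum>y\<in>K. \<Sum>g\<in>carrier G. of_nat (num_fact K n g) * F (g \<otimes> y))"
  proof (rule sum.cong[OF refl])
    fix y assume "y \<in> K"
    then have y: "y \<in> carrier G" using K by auto
    have "(\<Sum>g\<in>carrier G. of_nat (num_fact K n (g \<otimes> inv y)) * F g)
        = (\<Sum>g\<in>carrier G. of_nat (num_fact K n (g \<otimes> y \<otimes> inv y)) * F (g \<otimes> y))"
      by (rule sum.reindex_bij_betw[OF bij_mult_right[OF y], symmetric])
    then show "(\<Sum>g\<in>carrier G. of_nat (num_fact K n (g \<otimes> inv y)) * F g)
        = (\<Sum>g\<in>carrier G. of_nat (num_fact K n g) * F (g \<otimes> y))"
      using y by (simp add: m_assoc)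
  qed
  also have "\<dots> = (\<Sum>g\<in>carrier G. of_nat (num_fact K n g) * (\<Sum>y\<in>K. F (g \<otimes> y)))"
    by (subst sum.swap) (simp add: sum_distrib_left)
  finally show ?thesis .
qed

lemma sum_num_fact:
  assumes "K \<subseteq> carrier G"
  shows "(\<Sum>g\<in>carrier G. num_fact K n g) = card K ^ n"
proof (induction n)
  case 0
  then show ?case using finite_carrier by simp
next
  case (Suc n)
  then show ?case
    using sum_num_fact_Suc[OF assms, of n "\<lambda>_. 1 :: nat"] by (simp flip: sum_distrib_right)
qed

text \<open>Conjugating every factor by \<open>k\<close> permutes the class and carries
  factorizations of \<open>g\<close> to factorizations of its conjugate.\<close>

lemma num_fact_conj:
  assumes x: "x \<in> carrier G" and k: "k \<in> carrier G" and g: "g \<in> carrier G"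
  shows "num_fact (conj_class G x) n (k \<otimes> g \<otimes> inv k) = num_fact (conj_class G x) n g"
  using g
proof (induction n arbitrary: g)
  case 0
  have "k \<otimes> g \<otimes> inv k = \<one> \<longleftrightarrow> g = \<one>"
  proof
    assume "k \<otimes> g \<otimes> inv k = \<one>"
    then have "inv k \<otimes> (k \<otimes> g \<otimes> inv k) \<otimes> k = inv k \<otimes> \<one> \<otimes> k" by simp
    then show "g = \<one>" using k 0 by (simp add: m_assoc mult_inv_cancel)
  qed (use k in simp)
  then show ?case by simp
next
  case (Suc n)
  let ?K = "conj_class G x"
  have "num_fact ?K (Suc n) (k \<otimes> g \<otimes> inv k) = (\<Sum>y\<in>?K. num_fact ?K n (k \<otimes> g \<otimes> inv k \<otimes> inv (k \<otimes> y \<otimes> inv k)))"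
    by (simp, rule sum.reindex_bij_betw[OF bij_betw_conj_class[OF x k], symmetric])
  also have "\<dots> = (\<Sum>y\<in>?K. num_fact ?K n (k \<otimes> (g \<otimes> inv y) \<otimes> inv k))"
  proof (rule sum.cong[OF refl])
    fix y assume "y \<in> ?K"
    then have y: "y \<in> carrier G" using conj_class_subset[OF x] by auto
    then have "k \<otimes> g \<otimes> inv k \<otimes> inv (k \<otimes> y \<otimes> inv k) = k \<otimes> (g \<otimes> inv y) \<otimes> inv k"
      using k Suc.prems by (simp add: inv_mult_group m_assoc mult_inv_cancel)
    then show "num_fact ?K n (k \<otimes> g \<otimes> inv k \<otimes> inv (k \<otimes> y \<otimes> inv k)) = num_fact ?K n (k \<otimes> (g \<otimes> inv y) \<otimes> inv k)"
      by simp
  qed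
  also have "\<dots> = (\<Sum>y\<in>?K. num_fact ?K n (g \<otimes> inv y))"
    using conj_class_subset[OF x] Suc.prems by (intro sum.cong refl Suc.IH) auto
  finally show ?case by simp
qed

lemma Irr_conj_class:
  assumes "\<chi> \<in> Irr G" "x \<in> carrier G" "y \<in> conj_class G x"
  shows "\<chi> y = \<chi> x"
  using assms class_function_Irr[OF assms(1)] by (auto simp: conj_class_eq class_function_def)

text \<open>This is \<open>sum_class_function_mult\<close> for the indicator function of the class:
  each further factor from the class multiplies a character sum by the same scalar.\<close>

lemma sum_conj_class_mult:
  assumes \<chi>: "\<chi> \<in> Irr G" and x: "x \<in> carrier G" and g: "g \<in> carrier G"
  shows "\<chi> \<one> * (\<Sum>y\<in>conj_class G x. \<chi> (g \<otimes> y)) = of_nat (card (conj_class G x)) * \<chi> x * \<chi> g"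
proof -
  let ?K = "conj_class G x"
  define f where "f y = (if y \<in> ?K then 1 else (0 :: complex))" for y
  have f: "class_function f"
    by (auto simp: class_function_def f_def conj_class_closed_iff[OF x])
  have sum_f: "(\<Sum>h\<in>carrier G. f h * F h) = (\<Sum>y\<in>?K. F y)" for F
  proof -
    have "(\<Sum>y\<in>?K. F y) = (\<Sum>h\<in>carrier G. if h \<in> ?K then F h else 0)"
      using conj_class_subset[OF x] finite_carrier by (simp add: sum.inter_restrict[symmetric] Int_absorb1)
    then show ?thesis by (simp add: f_def if_distrib[of "\<lambda>x. x * _"] cong: if_cong)
  qed
  have "(\<Sum>y\<in>?K. \<chi> y) = of_nat (card ?K) * \<chi> x"
    using Irr_conj_class[OF \<chi> x] by simp
  then show ?thesis
    using sum_class_function_mult[OF f \<chi> g] by (simp add: sum_f mult_ac(2)[of "\<chi> g"])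
qed

lemma sum_num_fact_character:
  assumes \<chi>: "\<chi> \<in> Irr G" and x: "x \<in> carrier G"
  shows "(\<Sum>g\<in>carrier G. of_nat (num_fact (conj_class G x) n g) * \<chi> g)
    = \<chi> \<one> * (of_nat (card (conj_class G x)) * \<chi> x / \<chi> \<one>) ^ n"
proof (induction n)
  case 0
  have "(\<Sum>g\<in>carrier G. of_nat (num_fact (conj_class G x) 0 g) * \<chi> g) = (\<Sum>g\<in>carrier G. if g = \<one> then \<chi> g else 0)"
    by (intro sum.cong) auto
  then show ?case using finite_carrier by simp
next
  case (Suc n)
  let ?K = "conj_class G x"
  let ?w = "of_nat (card ?K) * \<chi> x / \<chi> \<one>"
  have "(\<Sum>g\<in>carrier G. of_nat (num_fact ?K (Suc n) g) * \<chi> g)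
      = (\<Sum>g\<in>carrier G. of_nat (num_fact ?K n g) * (\<Sum>y\<in>?K. \<chi> (g \<otimes> y)))"
    by (rule sum_num_fact_Suc[OF conj_class_subset[OF x]])
  also have "\<dots> = (\<Sum>g\<in>carrier G. ?w * (of_nat (num_fact ?K n g) * \<chi> g))"
  proof (rule sum.cong[OF refl])
    fix g assume "g \<in> carrier G"
    then have "(\<Sum>y\<in>?K. \<chi> (g \<otimes> y)) = ?w * \<chi> g"
      using sum_conj_class_mult[OF \<chi> x, of g] Irr_one_neq_0[OF \<chi>] by (simp add: field_simps)
    then show "of_nat (num_fact ?K n g) * (\<Sum>y\<in>?K. \<chi> (g \<otimes> y)) = ?w * (of_nat (num_fact ?K n g) * \<chi> g)"
      by simp
  qed
  also have "\<dots> = \<chi> \<one> * ?w ^ Suc n" unfolding sum_distrib_left[symmetric] Suc by simp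
  finally show ?case .
qed

text \<open>The exponent is an integer because \<open>n = 0\<close> is included, where it equals
  -1.\<close>

lemma num_fact_formula:
  assumes x: "x \<in> carrier G" and g: "g \<in> carrier G"
  shows "of_nat (num_fact (conj_class G x) n g)
    = of_nat (card (conj_class G x)) ^ n / of_nat (card (carrier G)) *
      (\<Sum>\<chi>\<in>Irr G. \<chi> x ^ n * cnj (\<chi> g) / \<chi> \<one> powi (int n - 1))"
proof -
  let ?K = "conj_class G x" and ?N = "of_nat (card (carrier G)) :: complex"
  define f where "f g = (of_nat (num_fact ?K n g) :: complex)" for g
  have "class_function f" using num_fact_conj[OF x] by (auto simp: class_function_def f_def)
  from class_function_expansion[OF this g]
  \<comment> \<open>The counts are real, so conjugating the expansion moves the conjugate from
    \<open>\<chi> h\<close> to \<open>\<chi> g\<close>.\<close>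
  have "cnj (f g) = (\<Sum>\<chi>\<in>Irr G. (\<Sum>h\<in>carrier G. f h * \<chi> h) / ?N * cnj (\<chi> g))"
    by (simp add: f_def)
  also have "\<dots> = (\<Sum>\<chi>\<in>Irr G. of_nat (card ?K) ^ n / ?N * (\<chi> x ^ n * cnj (\<chi> g) / \<chi> \<one> powi (int n - 1)))"
  proof (rule sum.cong[OF refl])
    fix \<chi> assume \<chi>: "\<chi> \<in> Irr G"
    have "\<chi> \<one> powi (int n - 1) = \<chi> \<one> ^ n / \<chi> \<one>"
      using Irr_one_neq_0[OF \<chi>] by (simp add: power_int_diff)
    then show "(\<Sum>h\<in>carrier G. f h * \<chi> h) / ?N * cnj (\<chi> g)
        = of_nat (card ?K) ^ n / ?N * (\<chi> x ^ n * cnj (\<chi> g) / \<chi> \<one> powi (int n - 1))"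
      using Irr_one_neq_0[OF \<chi>]
      unfolding f_def sum_num_fact_character[OF \<chi> x] by (simp add: power_mult_distrib power_divide mult_ac)
  qed
  finally show ?thesis by (simp add: f_def sum_distrib_left)
qed

end

section \<open>The criterion, read off from the counts at the identity and at
  \<open>d\<close>\<close>

theorem theorem12:
  fixes G :: "('a, 'b) monoid_scheme" (structure)
    and x d :: 'a and K D :: "'a set" and n :: nat and m1 m2 :: complex
  assumes "group G" and "finite (carrier G)"
    and "x \<in> carrier G" and "K = conj_class G x"
    and "d \<in> carrier G" and "D = conj_class G d" and "D \<noteq> {\<one>}"
    and "n > 0"
    and "m1 = of_nat (card K) ^ n / of_nat (card (carrier G)) *
           (\<Sum>\<chi>\<in>Irr G. \<chi> x ^ n / \<chi> \<one> powi (int n - 2))"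
    and "m2 = of_nat (card K) ^ n / of_nat (card (carrier G)) *
           (\<Sum>\<chi>\<in>Irr G. \<chi> x ^ n * cnj (\<chi> d) / \<chi> \<one> powi (int n - 1))"
  shows "set_power G K n = {\<one>} \<union> D \<longleftrightarrow>
           m1 \<in> \<nat> - {0} \<and> m2 \<in> \<nat> - {0} \<and>
           (\<forall>\<chi>\<in>Irr G. \<chi> x ^ n * of_nat (card K) ^ n =
              \<chi> \<one> powi (int n - 1) * (m1 * \<chi> \<one> + m2 * of_nat (card D) * \<chi> d)) \<and>
           of_nat (card K) ^ n = m1 + m2 * of_nat (card D)"
proof -
  interpret finite_group G by (simp add: finite_group_def finite_group_axioms_def assms)
  note x = assms(3) and K = assms(4) and d = assms(5) and D = assms(6)
  define N where "N = num_fact K n"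
  have K_sub: "K \<subseteq> carrier G" and D_sub: "D \<subseteq> carrier G"
    using conj_class_subset x d K D by auto
  have fin_D: "finite D" using D_sub finite_carrier finite_subset by blast
  have d_in_D: "d \<in> D" using d by (auto simp: D conj_class_eq intro!: image_eqI[of _ _ \<one>])
  \<comment> \<open>The class of the identity is \<open>{\<one>}\<close>, which \<open>D\<close> is
    assumed to differ from. Hence \<open>\<one>\<close> and \<open>D\<close> contribute separately
    to all sums below.\<close>
  have one_notin_D: "\<one> \<notin> D"
  proof
    assume "\<one> \<in> D"
    then obtain g where g: "g \<in> carrier G" "g \<otimes> d \<otimes> inv g = \<one>" using d by (auto simp: D conj_class_eq)
    then have "inv g \<otimes> (g \<otimes> d \<otimes> inv g) \<otimes> g = \<one>" by simp
    then have "d = \<one>" using g(1) d by (simp add: m_assoc mult_inv_cancel)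
    then have "D = {\<one>}" by (auto simp: D conj_class_eq)
    then show False using assms(7) by simp
  qed
  \<comment> \<open>The counting formula at \<open>\<one>\<close>: the degree
    \<open>\<chi> \<one>\<close> is real and lowers the exponent from \<open>n - 1\<close> to
    \<open>n - 2\<close>, which is -1 for \<open>n = 1\<close>.\<close>
  have "m1 = of_nat (card K) ^ n / of_nat (card (carrier G)) *
      (\<Sum>\<chi>\<in>Irr G. \<chi> x ^ n * cnj (\<chi> \<one>) / \<chi> \<one> powi (int n - 1))"
    unfolding assms(9)
  proof (intro arg_cong2[of _ _ _ _ "(*)"] refl sum.cong)
    fix \<chi> assume \<chi>: "\<chi> \<in> Irr G"
    then have "cnj (\<chi> \<one>) = \<chi> \<one>" by (elim IrrE) simp
    then show "\<chi> x ^ n / \<chi> \<one> powi (int n - 2) = \<chi> x ^ n * cnj (\<chi> \<one>) / \<chi> \<one> powi (int n - 1)"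
      using Irr_one_neq_0[OF \<chi>] by (simp add: power_int_diff power2_eq_square)
  qed
  then have m1: "m1 = of_nat (N \<one>)"
    using num_fact_formula[OF x one_closed, of n] by (simp add: N_def K)
  have m2: "m2 = of_nat (N d)"
    using num_fact_formula[OF x d, of n] assms(10) by (simp add: N_def K)
  have N_D: "N y = N d" if "y \<in> D" for y
    using that num_fact_conj[OF x _ d] d by (auto simp: N_def K D conj_class_eq)
  \<comment> \<open>By \<open>N_D\<close> the count is constant on \<open>D\<close>, so the single
    value \<open>N d\<close> decides whether the whole class occurs.\<close>
  have power_iff: "set_power G K n = {\<one>} \<union> D \<longleftrightarrow>
      N \<one> \<noteq> 0 \<and> N d \<noteq> 0 \<and> (\<forall>g\<in>carrier G. g \<notin> {\<one>} \<union> D \<longrightarrow> N g = 0)"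
  proof
    assume "set_power G K n = {\<one>} \<union> D"
    then have S: "{g \<in> carrier G. N g \<noteq> 0} = {\<one>} \<union> D"
      by (simp add: set_power_eq[OF K_sub] N_def)
    have "N g = 0" if "g \<in> carrier G" "g \<notin> {\<one>} \<union> D" for g
      using that unfolding S[symmetric] by simp
    moreover have "\<one> \<in> {g \<in> carrier G. N g \<noteq> 0}" "d \<in> {g \<in> carrier G. N g \<noteq> 0}"
      unfolding S using d_in_D by simp_all
    ultimately show "N \<one> \<noteq> 0 \<and> N d \<noteq> 0 \<and> (\<forall>g\<in>carrier G. g \<notin> {\<one>} \<union> D \<longrightarrow> N g = 0)" by simp
  next
    assume R: "N \<one> \<noteq> 0 \<and> N d \<noteq> 0 \<and> (\<forall>g\<in>carrier G. g \<notin> {\<one>} \<union> D \<longrightarrow> N g = 0)"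
    have "g \<in> {g \<in> carrier G. N g \<noteq> 0} \<longleftrightarrow> g \<in> {\<one>} \<union> D" for g
    proof (cases "g \<in> {\<one>} \<union> D")
      case True
      then have "g = \<one> \<or> g \<in> D" by simp
      then have "g \<in> carrier G \<and> N g \<noteq> 0"
      proof
        assume "g \<in> D"
        then show ?thesis using R N_D[of g] D_sub by (metis subsetD)
      qed (use R in simp)
      then show ?thesis using True by simp
    next
      case False
      then show ?thesis using R by (metis (mono_tags, lifting) mem_Collect_eq)
    qed
    then show "set_power G K n = {\<one>} \<union> D"
      unfolding set_power_eq[OF K_sub] N_def[symmetric] by (rule Set.set_eqI)
  qed
  \<comment> \<open>Polymorphic in the values, since it is applied to natural counts and to complex
    character sums.\<close>
  have split: "(\<Sum>g\<in>carrier G. F g) = F \<one> + (\<Sum>g\<in>D. F g) + (\<Sum>g\<in>carrier G - ({\<one>} \<union> D). F g)"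
    for F :: "'a \<Rightarrow> 'c::comm_monoid_add"
  proof -
    have "(\<Sum>g\<in>carrier G. F g) = (\<Sum>g\<in>carrier G - ({\<one>} \<union> D). F g) + (\<Sum>g\<in>{\<one>} \<union> D. F g)"
      using D_sub finite_carrier by (intro sum.subset_diff) auto
    then show ?thesis using fin_D one_notin_D by (simp add: add.commute)
  qed
  have total: "card K ^ n = N \<one> + N d * card D + (\<Sum>g\<in>carrier G - ({\<one>} \<union> D). N g)"
  proof -
    have "(\<Sum>g\<in>D. N g) = (\<Sum>g\<in>D. N d)" by (rule sum.cong[OF refl N_D])
    then show ?thesis
      using sum_num_fact[OF K_sub, of n] split[of N] by (simp add: N_def[symmetric] mult.commute)
  qed
  show ?thesis
  proof
    assume L: "set_power G K n = {\<one>} \<union> D"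
    then have N0: "N g = 0" if "g \<in> carrier G - ({\<one>} \<union> D)" for g
      using that power_iff by (metis DiffE)
    have "\<chi> x ^ n * of_nat (card K) ^ n =
        \<chi> \<one> powi (int n - 1) * (m1 * \<chi> \<one> + m2 * of_nat (card D) * \<chi> d)" if \<chi>: "\<chi> \<in> Irr G" for \<chi>
    proof -
      have "\<chi> \<one> * (of_nat (card K) * \<chi> x / \<chi> \<one>) ^ n = (\<Sum>g\<in>carrier G. of_nat (N g) * \<chi> g)"
        using sum_num_fact_character[OF \<chi> x, of n] by (simp add: N_def K)
      also have "\<dots> = m1 * \<chi> \<one> + (\<Sum>g\<in>D. of_nat (N g) * \<chi> g)"
        by (subst split) (simp add: N0 m1)
      also have "(\<Sum>g\<in>D. of_nat (N g) * \<chi> g) = (\<Sum>g\<in>D. m2 * \<chi> d)"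
      proof (rule sum.cong[OF refl])
        fix g assume "g \<in> D"
        then have "N g = N d" "\<chi> g = \<chi> d" using N_D Irr_conj_class[OF \<chi> d] D by auto
        then show "of_nat (N g) * \<chi> g = m2 * \<chi> d" by (simp only: m2)
      qed
      finally have "m1 * \<chi> \<one> + m2 * of_nat (card D) * \<chi> d = \<chi> \<one> * (of_nat (card K) * \<chi> x / \<chi> \<one>) ^ n"
        by (simp add: mult_ac)
      \<comment> \<open>Multiplying by this power of the degree cancels the denominators of the
        scalar.\<close>
      moreover have "\<chi> \<one> powi (int n - 1) = \<chi> \<one> ^ n / \<chi> \<one>"
        using Irr_one_neq_0[OF \<chi>] by (simp add: power_int_diff)
      ultimately show ?thesis
        using Irr_one_neq_0[OF \<chi>] by (simp add: power_mult_distrib power_divide)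
    qed
    moreover have "of_nat (card K) ^ n = m1 + m2 * of_nat (card D)"
      using total N0 by (simp add: m1 m2 flip: of_nat_power of_nat_mult of_nat_add)
    ultimately show "m1 \<in> \<nat> - {0} \<and> m2 \<in> \<nat> - {0} \<and>
        (\<forall>\<chi>\<in>Irr G. \<chi> x ^ n * of_nat (card K) ^ n =
          \<chi> \<one> powi (int n - 1) * (m1 * \<chi> \<one> + m2 * of_nat (card D) * \<chi> d)) \<and>
        of_nat (card K) ^ n = m1 + m2 * of_nat (card D)"
      using L power_iff by (simp add: m1 m2)
  next
    assume R: "m1 \<in> \<nat> - {0} \<and> m2 \<in> \<nat> - {0} \<and>
        (\<forall>\<chi>\<in>Irr G. \<chi> x ^ n * of_nat (card K) ^ n =
          \<chi> \<one> powi (int n - 1) * (m1 * \<chi> \<one> + m2 * of_nat (card D) * \<chi> d)) \<and>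
        of_nat (card K) ^ n = m1 + m2 * of_nat (card D)"
    \<comment> \<open>Pulled back to natural numbers and compared with \<open>total\<close>, the
      equation leaves a sum of counts outside \<open>{\<one>} \<union> D\<close> equal to 0. Natural
      summands must then all vanish, and \<open>m1\<close>, \<open>m2\<close> being nonzero puts
      \<open>\<one>\<close> and \<open>D\<close> into the power.\<close>
    then have "(of_nat (card K ^ n) :: complex) = of_nat (N \<one> + N d * card D)"
      by (simp add: m1 m2)
    then have "card K ^ n = N \<one> + N d * card D"
      unfolding of_nat_eq_iff .
    then have "(\<Sum>g\<in>carrier G - ({\<one>} \<union> D). N g) = 0" using total by simp
    then have rest: "\<forall>g\<in>carrier G - ({\<one>} \<union> D). N g = 0"
      using finite_carrier by simp
    have "N g = 0" if "g \<in> carrier G" "g \<notin> {\<one>} \<union> D" for g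
      using rest DiffI[OF that] by (rule bspec)
    then show "set_power G K n = {\<one>} \<union> D"
      using R unfolding power_iff by (simp add: m1 m2)
  qed
qed

end
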